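(* Let $\theta_\ast>0$, $\sigma>0$, and $c=8\log(4\theta_\ast\sigma^{-2})$. Consider the Poisson mixture model in which $X_1,\dots,X_n$ are i.i.d. with probability mass function $h_Q(x)=\int_0^{\theta_\ast}\frac{e^{-\theta}\theta^x}{x!}\,\mathrm dQ(\theta)$, $x\in\mathbb Z^{\ge0}$, with $Q\in\mathcal P([0,\theta_\ast])$ unknown. Let $d$ be a generalized distance for which there exist constants $\gamma_3,\gamma_4>0$ with $\gamma_3H^2(p,q)\le d(p\Vert q)\le\gamma_4\chi^2(p\Vert q)$ for all $p,q\in\mathcal P(\mathbb Z^{\ge0})$, and let $\hat Q_d$ be any element of $\operatorname*{argmin}_{\tilde Q\in\mathcal P([0,\theta_\ast])}d(h^{\rm obs}\Vert h_{\tilde Q})$. Then $$\sup_{Q\in\mathcal P([0,\theta_\ast])}\mathbb E\,W_1^\sigma(Q,\hat Q_d)\le\begin{cases}C(\theta_\ast,\sigma^2,\gamma_3,\gamma_4)\cdot n^{-0.5+c/\log\log n}\,\mathrm{Polylog}(n), & \text{if } \sigma^2<4\theta_\ast,\\ C(\theta_\ast,\sigma^2,\gamma_3,\gamma_4)\cdot n^{-0.5}\,\mathrm{Polylog}(n), & \text{if } \sigma^2\ge4\theta_\ast,\end{cases}$$ where $C(\theta_\ast,\sigma^2,\gamma_3,\gamma_4)>0$ is a constant depending only on the indicated quantities.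
   Context: $\mathcal P(A)$ denotes the set of probability measures on $A$; $\mathbb Z^{\ge0}=\{0,1,2,\dots\}$. A generalized distance is a map $d:\mathcal P(\mathbb Z^{\ge0})\times\mathcal P(\mathbb Z^{\ge0})\to\mathbb R^{\ge0}$, written $d(p\Vert q)$, with $d(p\Vert q)=0$ iff $p=q$. $H^2(p,q)=\frac12\sum_{x\ge0}(\sqrt{p(x)}-\sqrt{q(x)})^2$ and $\chi^2(p\Vert q)=\sum_{x\ge0}(p(x)-q(x))^2/q(x)$. The empirical distribution is $h^{\rm obs}(x)=\frac1n\sum_{i=1}^n\mathbf 1(X_i=x)$. $W_1$ is the Wasserstein-1 distance and $W_1^\sigma(Q,Q')=W_1(Q\ast\mathcal N(0,\sigma^2),Q'\ast\mathcal N(0,\sigma^2))$, with $\ast$ denoting convolution. The expectation is over $X_1,\dots,X_n$ i.i.d. from $h_Q$. $\mathrm{Polylog}(n)$ denotes a factor of the form $(\log n)^a$ for some constant $a>0$ not depending on $n$; the bound is asserted for all sufficiently large $n$. *)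

theory Defs
  imports "HOL-Probability.Probability"
begin

definition prob_on_interval :: "real \<Rightarrow> real measure \<Rightarrow> bool" where
  "prob_on_interval ts Q \<longleftrightarrow> sets Q = sets borel \<and> prob_space Q \<and> emeasure Q {0..ts} = 1"

definition mix_pmf :: "real measure \<Rightarrow> nat pmf" where
  "mix_pmf Q = embed_pmf (\<lambda>x. integral\<^sup>L Q (\<lambda>\<theta>. exp (- \<theta>) * \<theta> ^ x / fact x))"

definition empirical :: "nat list \<Rightarrow> nat pmf" where
  "empirical xs = pmf_of_multiset (mset xs)"

definition hellinger2 :: "nat pmf \<Rightarrow> nat pmf \<Rightarrow> real" where
  "hellinger2 p q = (1/2) * (\<Sum>x. (sqrt (pmf p x) - sqrt (pmf q x))^2)"

definition chi2 :: "nat pmf \<Rightarrow> nat pmf \<Rightarrow> ennreal" where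
  "chi2 p q = (\<integral>\<^sup>+ x. (if pmf q x = 0 then (if pmf p x = 0 then 0 else \<infinity>)
                        else ennreal ((pmf p x - pmf q x)^2 / pmf q x)) \<partial>count_space UNIV)"

definition generalized_distance :: "(nat pmf \<Rightarrow> nat pmf \<Rightarrow> real) \<Rightarrow> bool" where
  "generalized_distance d \<longleftrightarrow> (\<forall>p q. d p q \<ge> 0 \<and> (d p q = 0 \<longleftrightarrow> p = q))"

definition couplings :: "real measure \<Rightarrow> real measure \<Rightarrow> (real \<times> real) measure set" where
  "couplings \<mu> \<nu> = {\<pi>. sets \<pi> = sets (borel :: (real \<times> real) measure) \<and> prob_space \<pi> \<and>
       distr \<pi> borel fst = \<mu> \<and> distr \<pi> borel snd = \<nu>}"

definition W1 :: "real measure \<Rightarrow> real measure \<Rightarrow> ennreal" where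
  "W1 \<mu> \<nu> = (INF \<pi>\<in>couplings \<mu> \<nu>. \<integral>\<^sup>+ z. ennreal \<bar>fst z - snd z\<bar> \<partial>\<pi>)"

definition gaussian :: "real \<Rightarrow> real measure" where
  "gaussian \<sigma> = density lborel (normal_density 0 \<sigma>)"

definition W1_smooth :: "real \<Rightarrow> real measure \<Rightarrow> real measure \<Rightarrow> ennreal" where
  "W1_smooth \<sigma> Q Q' = W1 (Q \<star> gaussian \<sigma>) (Q' \<star> gaussian \<sigma>)"

definition is_min_dist_estimator ::
  "real \<Rightarrow> (nat pmf \<Rightarrow> nat pmf \<Rightarrow> real) \<Rightarrow> (nat list \<Rightarrow> real measure) \<Rightarrow> bool" where
  "is_min_dist_estimator ts d Qhat \<longleftrightarrow>
     (\<forall>xs. xs \<noteq> [] \<longrightarrow> prob_on_interval ts (Qhat xs) \<and>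
        (\<forall>Q'. prob_on_interval ts Q' \<longrightarrow>
              d (empirical xs) (mix_pmf (Qhat xs)) \<le> d (empirical xs) (mix_pmf Q')))"

definition rate :: "real \<Rightarrow> real \<Rightarrow> real \<Rightarrow> nat \<Rightarrow> real" where
  "rate ts \<sigma> a n =
     (let c = 8 * ln (4 * ts / \<sigma>^2) in
      (if \<sigma>^2 < 4 * ts then real n powr (-0.5 + c / ln (ln (real n)))
       else real n powr (-0.5)) * ln (real n) powr a)"

end

theory Submission
  imports Defs "HOL-Complex_Analysis.Complex_Analysis" "HOL-Real_Asymp.Real_Asymp"
begin

text \<open>
  Smoothing turns \<open>Q\<close> into a density \<open>f\<^sub>Q\<close>, and a coupling that leaves the common part of two
  densities in place gives \<open>W\<^sub>1 \<le> \<integral> |t| |f\<^sub>Q(t) - f\<^sub>Q\<^sub>'(t)| dt\<close>. The function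
  \<open>\<theta> \<mapsto> e\<^sup>\<theta> \<phi>\<^sub>\<sigma>(t - \<theta>)\<close> is entire, so expanding it in powers of \<open>\<theta>\<close> writes \<open>f\<^sub>Q(t)\<close> as a linear functional
  \<open>\<Sum>\<^sub>x c\<^sub>x(t) x! h\<^sub>Q(x)\<close> of the mixture. Cauchy's inequality on the circle of radius about \<open>\<sigma> \<surd>(x/2)\<close>
  bounds \<open>c\<^sub>x\<close>, and integrating over \<open>t\<close> yields
  \<open>W\<^sub>1\<^sup>\<sigma>(Q, Q') \<le> M \<Sum>\<^sub>x (2/\<sigma>)\<^sup>x \<surd>(x!) |h\<^sub>Q(x) - h\<^sub>Q\<^sub>'(x)|\<close>.
  As \<open>h\<^sub>Q(x) \<le> \<theta>\<^sub>*\<^sup>x / x!\<close>, the terms with \<open>x < k\<close> are at most \<open>2 (4\<theta>\<^sub>*/\<sigma>\<^sup>2)\<^bsup>x/2\<^esup>\<close> times the difference of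
  the square roots of the two mixtures, and the remaining ones are super-exponentially small in \<open>k\<close>.
  The differences of square roots are controlled by the Hellinger distance, hence, by minimality of the
  estimator, by the chi-square divergence of the empirical distribution from \<open>h\<^sub>Q\<close>. This divergence has
  infinite expectation in general, so it is used only when all observations are below \<open>k\<close>, where its
  expectation is of order \<open>k/n\<close>; otherwise the distance is bounded by a constant. The choice
  \<open>k \<approx> 8 log n / log log n\<close> balances the terms.
\<close>

section \<open>Wasserstein distance between densities\<close>

text \<open>One explicit coupling gives the bound. The common part \<open>min (f t) (g t)\<close>
  stays on the diagonal; the excess of \<open>f\<close> over \<open>g\<close> and that of
  \<open>g\<close> over \<open>f\<close> have equal mass \<open>m\<close> and are coupled
  independently, with density \<open>p x * q y / m\<close>. Only this second part costs anything,
  the triangle inequality separates its two coordinates, and \<open>p + q\<close> is the absolute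
  difference of the densities.\<close>

lemma W1_density_le:
  fixes f g :: "real \<Rightarrow> real"
  assumes [measurable]: "f \<in> borel_measurable borel" "g \<in> borel_measurable borel"
    and nonneg: "\<And>t. 0 \<le> f t" "\<And>t. 0 \<le> g t"
    and total: "(\<integral>\<^sup>+ t. ennreal (f t) \<partial>lborel) = 1" "(\<integral>\<^sup>+ t. ennreal (g t) \<partial>lborel) = 1"
  shows "W1 (density lborel f) (density lborel g) \<le> (\<integral>\<^sup>+ t. ennreal (\<bar>t\<bar> * \<bar>f t - g t\<bar>) \<partial>lborel)"
proof -
  define r where "r t = ennreal (min (f t) (g t))" for t
  define p where "p t = ennreal (f t - g t)" for t
  define q where "q t = ennreal (g t - f t)" for t
  define m where "m = (\<integral>\<^sup>+ t. p t \<partial>lborel)"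
  have [measurable]: "r \<in> borel_measurable borel" "p \<in> borel_measurable borel" "q \<in> borel_measurable borel"
    by (simp_all add: r_def[abs_def] p_def[abs_def] q_def[abs_def])
  have rp: "r t + p t = f t" and rq: "r t + q t = g t" for t
    using nonneg[of t] unfolding r_def p_def q_def
    by (cases "f t \<le> g t"; simp add: ennreal_neg flip: ennreal_plus)+
  have rm: "(\<integral>\<^sup>+ t. r t \<partial>lborel) + m = 1"
    unfolding m_def by (subst nn_integral_add[symmetric]) (simp_all add: rp total)
  \<comment> \<open>Both densities have total mass 1 and the common part has finite mass, so it
    cancels and the two excesses have the same mass.\<close>
  have "(\<integral>\<^sup>+ t. r t \<partial>lborel) + (\<integral>\<^sup>+ t. q t \<partial>lborel) = 1"
    by (subst nn_integral_add[symmetric]) (simp_all add: rq total)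
  moreover have "(\<integral>\<^sup>+ t. r t \<partial>lborel) \<noteq> \<infinity>" using rm
    by (metis ennreal_add_eq_top ennreal_one_neq_top infinity_ennreal_def)
  ultimately have qm: "(\<integral>\<^sup>+ t. q t \<partial>lborel) = m"
    using rm by (metis ennreal_add_left_cancel)
  have mfin: "m \<noteq> \<infinity>" using rm by (metis ennreal_add_eq_top ennreal_one_neq_top infinity_ennreal_def)
  \<comment> \<open>The diagonal part has no density on the plane. The boolean coordinate labels the
    two parts, so that their sum becomes the image under \<open>T\<close> of a single density over a
    product of sigma-finite measures.\<close>
  define B where "B = count_space (UNIV :: bool set) \<Otimes>\<^sub>M (lborel \<Otimes>\<^sub>M lborel :: (real \<times> real) measure)"
  \<comment> \<open>On the diagonal branch \<open>y\<close> is a dummy coordinate; the indicator of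
    the unit interval integrates it out to 1.\<close>
  define h :: "bool \<times> real \<times> real \<Rightarrow> ennreal" where
    "h = (\<lambda>(b, x, y). if b then r x * indicator {0..1} y else p x * q y / m)"
  define T :: "bool \<times> real \<times> real \<Rightarrow> real \<times> real" where
    "T = (\<lambda>(b, x, y). if b then (x, x) else (x, y))"
  define \<pi> where "\<pi> = distr (density B h) borel T"
  interpret sigma_finite_measure "count_space (UNIV :: bool set)"
    by (rule sigma_finite_measure_count_space)
  have [measurable]: "h \<in> borel_measurable B" "T \<in> borel_measurable B"
    unfolding h_def T_def B_def by measurable
  \<comment> \<open>Integration rule for the coupling; both marginals and the transport cost are
    instances of it.\<close>
  have nn: "(\<integral>\<^sup>+ z. F z \<partial>\<pi>) = (\<integral>\<^sup>+ x. F (x, x) * r x \<partial>lborel)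
      + (\<integral>\<^sup>+ x. \<integral>\<^sup>+ y. F (x, y) * p x * q y / m \<partial>lborel \<partial>lborel)"
    if [measurable]: "F \<in> borel_measurable borel" for F :: "real \<times> real \<Rightarrow> ennreal"
  proof -
    have [measurable]: "F \<in> borel_measurable (lborel \<Otimes>\<^sub>M lborel)"
      by (simp add: lborel_prod)
    have "(\<integral>\<^sup>+ z. F z \<partial>\<pi>) = (\<integral>\<^sup>+ z. h z * F (T z) \<partial>B)"
      unfolding \<pi>_def by (simp add: nn_integral_distr nn_integral_density)
    also have "\<dots> = (\<integral>\<^sup>+ b. \<integral>\<^sup>+ z. h (b, z) * F (T (b, z)) \<partial>(lborel \<Otimes>\<^sub>M lborel) \<partial>count_space UNIV)"
      unfolding B_def
      by (rule lborel_pair.nn_integral_fst[symmetric]) (simp add: flip: B_def)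
    also have "\<dots> = (\<Sum>b\<in>UNIV. \<integral>\<^sup>+ z. h (b, z) * F (T (b, z)) \<partial>(lborel \<Otimes>\<^sub>M lborel))"
      by (rule nn_integral_count_space_finite) simp
    also have "\<dots> = (\<integral>\<^sup>+ z. h (True, z) * F (T (True, z)) \<partial>(lborel \<Otimes>\<^sub>M lborel))
        + (\<integral>\<^sup>+ z. h (False, z) * F (T (False, z)) \<partial>(lborel \<Otimes>\<^sub>M lborel))"
      by (simp add: UNIV_bool add.commute)
    also have "(\<integral>\<^sup>+ z. h (True, z) * F (T (True, z)) \<partial>(lborel \<Otimes>\<^sub>M lborel))
        = (\<integral>\<^sup>+ x. \<integral>\<^sup>+ y. r x * indicator {0..1::real} y * F (x, x) \<partial>lborel \<partial>lborel)"
      unfolding h_def T_def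
      by (subst lborel.nn_integral_fst[symmetric]) simp_all
    also have "\<dots> = (\<integral>\<^sup>+ x. F (x, x) * r x \<partial>lborel)"
      by (simp add: nn_integral_cmult nn_integral_multc mult.commute)
    also have "(\<integral>\<^sup>+ z. h (False, z) * F (T (False, z)) \<partial>(lborel \<Otimes>\<^sub>M lborel))
        = (\<integral>\<^sup>+ x. \<integral>\<^sup>+ y. F (x, y) * p x * q y / m \<partial>lborel \<partial>lborel)"
      unfolding h_def T_def
      by (subst lborel.nn_integral_fst[symmetric])
        (simp, simp add: mult_ac divide_ennreal_def)
    finally show ?thesis .
  qed
  have mdiv: "p x * m / m = p x" "q x * m / m = q x" if "m \<noteq> 0" for x
    using that mfin by (simp_all add: ennreal_mult_divide_eq)
  \<comment> \<open>If \<open>m = 0\<close>, the excesses vanish almost everywhere, and both sides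
    of the identities \<open>left\<close> and \<open>right\<close> are zero.\<close>
  have z: "AE x in lborel. p x = 0" "AE x in lborel. q x = 0" if "m = 0"
    using that[unfolded m_def] that[folded qm] by (simp_all add: nn_integral_0_iff_AE)
  have left: "(\<integral>\<^sup>+ x. \<integral>\<^sup>+ y. G x * p x * q y / m \<partial>lborel \<partial>lborel) = (\<integral>\<^sup>+ x. G x * p x \<partial>lborel)"
    if [measurable]: "G \<in> borel_measurable borel" for G :: "real \<Rightarrow> ennreal"
  proof -
    have "(\<integral>\<^sup>+ x. \<integral>\<^sup>+ y. G x * p x * q y / m \<partial>lborel \<partial>lborel) = (\<integral>\<^sup>+ x. G x * (p x * m / m) \<partial>lborel)"
      by (simp add: nn_integral_cmult nn_integral_divide qm ennreal_times_divide mult.assoc)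
    also have "\<dots> = (\<integral>\<^sup>+ x. G x * p x \<partial>lborel)"
    proof (cases "m = 0")
      case True
      then show ?thesis using z(1) by (intro nn_integral_cong_AE) (auto elim!: eventually_mono)
    qed (simp add: mdiv)
    finally show ?thesis .
  qed
  have right: "(\<integral>\<^sup>+ x. \<integral>\<^sup>+ y. G y * p x * q y / m \<partial>lborel \<partial>lborel) = (\<integral>\<^sup>+ y. G y * q y \<partial>lborel)"
    if [measurable]: "G \<in> borel_measurable borel" for G :: "real \<Rightarrow> ennreal"
  proof -
    have "(\<integral>\<^sup>+ x. \<integral>\<^sup>+ y. G y * p x * q y / m \<partial>lborel \<partial>lborel) = (\<integral>\<^sup>+ y. \<integral>\<^sup>+ x. p x * (G y * q y / m) \<partial>lborel \<partial>lborel)"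
      by (subst lborel_pair.Fubini') (simp_all add: mult_ac divide_ennreal_def)
    also have "\<dots> = (\<integral>\<^sup>+ y. G y * (q y * m / m) \<partial>lborel)"
      by (simp add: nn_integral_multc flip: m_def) (simp add: mult_ac divide_ennreal_def)
    also have "\<dots> = (\<integral>\<^sup>+ y. G y * q y \<partial>lborel)"
    proof (cases "m = 0")
      case True
      then show ?thesis using z(2) by (intro nn_integral_cong_AE) (auto elim!: eventually_mono)
    qed (simp add: mdiv)
    finally show ?thesis .
  qed
  have sets [measurable_cong]: "sets \<pi> = sets borel" by (simp add: \<pi>_def)
  have [measurable]: "fst \<in> borel_measurable (borel :: (real \<times> real) measure)"
      "snd \<in> borel_measurable (borel :: (real \<times> real) measure)"
    by (auto intro!: borel_measurable_continuous_onI continuous_intros)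
  have [measurable]: "fst \<in> borel_measurable \<pi>" "snd \<in> borel_measurable \<pi>"
    by (simp_all cong: measurable_cong_sets[OF sets refl])
  have fst: "distr \<pi> borel fst = density lborel f"
  proof (rule measure_eqI)
    fix A assume "A \<in> sets (distr \<pi> borel fst)"
    then have [measurable]: "A \<in> sets borel" by simp
    have "emeasure (distr \<pi> borel fst) A = (\<integral>\<^sup>+ x. indicator A x \<partial>distr \<pi> borel fst)"
      by simp
    also have "\<dots> = (\<integral>\<^sup>+ z. indicator A (fst z) \<partial>\<pi>)"
      by (rule nn_integral_distr) simp_all
    also have "\<dots> = (\<integral>\<^sup>+ x. indicator A x * r x \<partial>lborel) + (\<integral>\<^sup>+ x. indicator A x * p x \<partial>lborel)"
      by (subst nn) (simp_all add: left)
    also have "\<dots> = (\<integral>\<^sup>+ x. indicator A x * ennreal (f x) \<partial>lborel)"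
      by (subst nn_integral_add[symmetric]) (simp_all add: flip: rp distrib_left)
    finally show "emeasure (distr \<pi> borel fst) A = emeasure (density lborel f) A"
      by (simp add: emeasure_density mult.commute)
  qed simp
  have snd: "distr \<pi> borel snd = density lborel g"
  proof (rule measure_eqI)
    fix A assume "A \<in> sets (distr \<pi> borel snd)"
    then have [measurable]: "A \<in> sets borel" by simp
    have "emeasure (distr \<pi> borel snd) A = (\<integral>\<^sup>+ x. indicator A x \<partial>distr \<pi> borel snd)"
      by simp
    also have "\<dots> = (\<integral>\<^sup>+ z. indicator A (snd z) \<partial>\<pi>)"
      by (rule nn_integral_distr) simp_all
    also have "\<dots> = (\<integral>\<^sup>+ x. indicator A x * r x \<partial>lborel) + (\<integral>\<^sup>+ x. indicator A x * q x \<partial>lborel)"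
      by (subst nn) (simp_all add: right)
    also have "\<dots> = (\<integral>\<^sup>+ x. indicator A x * ennreal (g x) \<partial>lborel)"
      by (subst nn_integral_add[symmetric]) (simp_all add: flip: rq distrib_left)
    finally show "emeasure (distr \<pi> borel snd) A = emeasure (density lborel g) A"
      by (simp add: emeasure_density mult.commute)
  qed simp
  have "emeasure (distr \<pi> borel fst) UNIV = 1"
    unfolding fst using total by (simp add: emeasure_density)
  then have "emeasure \<pi> (space \<pi>) = 1"
    by (subst (asm) emeasure_distr) (simp_all add: sets cong: measurable_cong_sets)
  then have "prob_space \<pi>" by (rule prob_spaceI)
  then have "\<pi> \<in> couplings (density lborel f) (density lborel g)"
    by (simp add: couplings_def sets fst snd)
  then have "W1 (density lborel f) (density lborel g) \<le> (\<integral>\<^sup>+ z. ennreal \<bar>fst z - snd z\<bar> \<partial>\<pi>)"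
    unfolding W1_def by (rule INF_lower)
  also have "\<dots> = (\<integral>\<^sup>+ x. \<integral>\<^sup>+ y. ennreal \<bar>x - y\<bar> * p x * q y / m \<partial>lborel \<partial>lborel)"
    by (subst nn) simp_all
  also have "\<dots> \<le> (\<integral>\<^sup>+ x. \<integral>\<^sup>+ y. ennreal \<bar>x\<bar> * p x * q y / m + ennreal \<bar>y\<bar> * p x * q y / m \<partial>lborel \<partial>lborel)"
  proof (intro nn_integral_mono)
    fix x y :: real
    have "ennreal \<bar>x - y\<bar> \<le> ennreal \<bar>x\<bar> + ennreal \<bar>y\<bar>"
      using ennreal_leI[OF abs_triangle_ineq4[of x y]] by simp
    then have "ennreal \<bar>x - y\<bar> * (p x * q y * inverse m) \<le> (ennreal \<bar>x\<bar> + ennreal \<bar>y\<bar>) * (p x * q y * inverse m)"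
      by (rule mult_right_mono) simp
    then show "ennreal \<bar>x - y\<bar> * p x * q y / m \<le> ennreal \<bar>x\<bar> * p x * q y / m + ennreal \<bar>y\<bar> * p x * q y / m"
      by (simp add: divide_ennreal_def distrib_right mult.assoc)
  qed
  also have "\<dots> = (\<integral>\<^sup>+ x. \<integral>\<^sup>+ y. ennreal \<bar>x\<bar> * p x * q y / m \<partial>lborel \<partial>lborel)
      + (\<integral>\<^sup>+ x. \<integral>\<^sup>+ y. ennreal \<bar>y\<bar> * p x * q y / m \<partial>lborel \<partial>lborel)"
    by (subst nn_integral_add[symmetric]) (auto intro!: nn_integral_cong nn_integral_add)
  also have "\<dots> = (\<integral>\<^sup>+ x. ennreal \<bar>x\<bar> * p x \<partial>lborel) + (\<integral>\<^sup>+ x. ennreal \<bar>x\<bar> * q x \<partial>lborel)"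
    by (simp add: left right)
  also have "\<dots> = (\<integral>\<^sup>+ t. ennreal (\<bar>t\<bar> * \<bar>f t - g t\<bar>) \<partial>lborel)"
  proof (subst nn_integral_add[symmetric]; (rule nn_integral_cong)?)
    fix t
    have "p t + q t = ennreal \<bar>f t - g t\<bar>"
      unfolding p_def q_def by (cases "f t \<le> g t") (simp_all add: ennreal_neg)
    then show "ennreal \<bar>t\<bar> * p t + ennreal \<bar>t\<bar> * q t = ennreal (\<bar>t\<bar> * \<bar>f t - g t\<bar>)"
      by (simp add: ennreal_mult flip: distrib_left)
  qed simp_all
  finally show ?thesis .
qed

section \<open>Gaussian smoothing\<close>

lemma prob_on_intervalD:
  assumes "prob_on_interval ts Q"
  shows "sets Q = sets borel" "prob_space Q" "AE \<theta> in Q. 0 \<le> \<theta> \<and> \<theta> \<le> ts"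
proof -
  show 1: "sets Q = sets borel" "prob_space Q"
    using assms by (simp_all add: prob_on_interval_def)
  interpret prob_space Q by fact
  have "prob {0..ts} = 1"
    using assms by (simp add: prob_on_interval_def emeasure_eq_measure)
  then have "AE \<theta> in Q. \<theta> \<in> {0..ts}" by (intro AE_prob_1)
  then show "AE \<theta> in Q. 0 \<le> \<theta> \<and> \<theta> \<le> ts" by simp
qed

lemma integrable_prob_on_interval:
  fixes f :: "real \<Rightarrow> real"
  assumes Q: "prob_on_interval ts Q" and [measurable]: "f \<in> borel_measurable borel"
    and "\<And>\<theta>. 0 \<le> \<theta> \<Longrightarrow> \<theta> \<le> ts \<Longrightarrow> \<bar>f \<theta>\<bar> \<le> B"
  shows "integrable Q f"
proof -
  note D = prob_on_intervalD[OF Q]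
  interpret prob_space Q by (rule D)
  show ?thesis
  proof (rule integrable_const_bound)
    show "AE x in Q. norm (f x) \<le> B" using D(3) by eventually_elim (use assms(3) in auto)
    show "f \<in> borel_measurable Q" using D(1) by (simp cong: measurable_cong_sets)
  qed
qed

definition smoothed :: "real \<Rightarrow> real measure \<Rightarrow> real \<Rightarrow> real" where
  "smoothed \<sigma> Q t = (\<integral>\<theta>. normal_density 0 \<sigma> (t - \<theta>) \<partial>Q)"

lemma normal_density_le:
  assumes "\<sigma> > 0" shows "normal_density 0 \<sigma> x \<le> 1 / sqrt (2 * pi * \<sigma>\<^sup>2)"
  unfolding normal_density_def by (rule mult_right_le_one_le) auto

text \<open>Translating the Gaussian by \<theta> and exchanging the two integrals exhibits the
  density of the convolution. Boundedness of the normal density makes the Bochner integral in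
  \<open>smoothed\<close> agree with the nonnegative one; the total mass is read off from the
  convolution.\<close>

lemma
  assumes "prob_on_interval ts Q" and \<sigma>: "\<sigma> > 0"
  shows smoothed_nonneg: "0 \<le> smoothed \<sigma> Q t"
    and borel_measurable_smoothed: "smoothed \<sigma> Q \<in> borel_measurable borel"
    and convolution_gaussian: "Q \<star> gaussian \<sigma> = density lborel (smoothed \<sigma> Q)"
    and nn_integral_smoothed: "(\<integral>\<^sup>+ t. ennreal (smoothed \<sigma> Q t) \<partial>lborel) = 1"
proof -
  note D = prob_on_intervalD[OF assms(1)]
  interpret Q: prob_space Q by (rule D)
  interpret G: prob_space "gaussian \<sigma>"
    unfolding gaussian_def using \<sigma> by (rule prob_space_normal_density)
  interpret pair_sigma_finite Q lborel ..
  have [measurable_cong]: "sets Q = sets borel" by (rule D)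
  have gs [measurable_cong]: "sets (gaussian \<sigma>) = sets borel" by (simp add: gaussian_def)
  show nonneg: "0 \<le> smoothed \<sigma> Q t" for t
    unfolding smoothed_def by (rule Bochner_Integration.integral_nonneg) simp
  show meas [measurable]: "smoothed \<sigma> Q \<in> borel_measurable borel"
    unfolding smoothed_def[abs_def] by measurable
  have int: "integrable Q (\<lambda>\<theta>. normal_density 0 \<sigma> (t - \<theta>))" for t
    by (rule integrable_prob_on_interval[OF assms(1), where B = "1 / sqrt (2 * pi * \<sigma>\<^sup>2)"])
      (use normal_density_le[OF \<sigma>] in auto)
  have eq: "ennreal (smoothed \<sigma> Q t) = (\<integral>\<^sup>+ \<theta>. ennreal (normal_density 0 \<sigma> (t - \<theta>)) \<partial>Q)" for t
    unfolding smoothed_def by (rule nn_integral_eq_integral[symmetric, OF int]) simp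
  show conv: "Q \<star> gaussian \<sigma> = density lborel (smoothed \<sigma> Q)"
  proof (rule measure_eqI)
    fix A assume "A \<in> sets (Q \<star> gaussian \<sigma>)"
    then have [measurable]: "A \<in> sets borel" by simp
    have "emeasure (Q \<star> gaussian \<sigma>) A = (\<integral>\<^sup>+ \<theta>. \<integral>\<^sup>+ y. indicator A (\<theta> + y) \<partial>gaussian \<sigma> \<partial>Q)"
      by (rule convolution_emeasure') (auto simp: gs D(1) intro: Q.finite_measure_axioms G.finite_measure_axioms)
    also have "\<dots> = (\<integral>\<^sup>+ \<theta>. \<integral>\<^sup>+ t. ennreal (normal_density 0 \<sigma> (t - \<theta>)) * indicator A t \<partial>lborel \<partial>Q)"
    proof (rule nn_integral_cong)
      fix \<theta> :: real
      have "(\<integral>\<^sup>+ y. indicator A (\<theta> + y) \<partial>gaussian \<sigma>)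
          = (\<integral>\<^sup>+ y. ennreal (normal_density 0 \<sigma> y) * indicator A (\<theta> + y) \<partial>lborel)"
        unfolding gaussian_def by (rule nn_integral_density) auto
      also have "\<dots> = (\<integral>\<^sup>+ t. ennreal (normal_density 0 \<sigma> (t - \<theta>)) * indicator A t \<partial>lborel)"
        by (subst nn_integral_real_affine[where c = 1 and t = "- \<theta>"]) (auto simp: add.commute)
      finally show "(\<integral>\<^sup>+ y. indicator A (\<theta> + y) \<partial>gaussian \<sigma>)
          = (\<integral>\<^sup>+ t. ennreal (normal_density 0 \<sigma> (t - \<theta>)) * indicator A t \<partial>lborel)" .
    qed
    also have "\<dots> = (\<integral>\<^sup>+ t. \<integral>\<^sup>+ \<theta>. ennreal (normal_density 0 \<sigma> (t - \<theta>)) * indicator A t \<partial>Q \<partial>lborel)"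
      by (rule Fubini'[symmetric]) measurable
    also have "\<dots> = (\<integral>\<^sup>+ t. ennreal (smoothed \<sigma> Q t) * indicator A t \<partial>lborel)"
      unfolding eq by (intro nn_integral_cong nn_integral_multc) measurable
    also have "\<dots> = emeasure (density lborel (smoothed \<sigma> Q)) A"
      by (rule emeasure_density[symmetric]) measurable
    finally show "emeasure (Q \<star> gaussian \<sigma>) A = emeasure (density lborel (smoothed \<sigma> Q)) A" .
  qed simp
  have "emeasure (Q \<star> gaussian \<sigma>) UNIV = (\<integral>\<^sup>+ \<theta>. \<integral>\<^sup>+ y. indicator UNIV (\<theta> + y) \<partial>gaussian \<sigma> \<partial>Q)"
    by (rule convolution_emeasure') (auto simp: gs D(1) intro: Q.finite_measure_axioms G.finite_measure_axioms)
  also have "\<dots> = 1"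
    by (simp add: Q.emeasure_space_1 G.emeasure_space_1)
  finally show "(\<integral>\<^sup>+ t. ennreal (smoothed \<sigma> Q t) \<partial>lborel) = 1"
    unfolding conv by (simp add: emeasure_density)
qed

section \<open>Poisson mixtures\<close>

text \<open>The left side divides the right side in the naturals. It factors the term at index
  \<open>k\<close> out of the tails of factorial series.\<close>

lemma fact_mult_fact_le_fact_add:
  "fact k * fact j \<le> (fact (j + k) :: 'a :: linordered_semidom)"
proof -
  have "fact k * fact j \<le> (fact (j + k) :: nat)"
    using fact_fact_dvd_fact[of j k, where 'a = nat] dvd_imp_le[of _ "fact (j + k) :: nat"]
    by (simp add: mult.commute)
  then have "of_nat (fact k * fact j) \<le> (of_nat (fact (j + k)) :: 'a)" by (rule of_nat_mono)
  then show ?thesis by simp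
qed

text \<open>\<open>embed_pmf\<close> returns the intended values for a nonnegative function of total
  mass one. The mass is computed by exchanging sum and integral and summing the exponential series
  for each \<theta>; the upper bound is that of the integrand on \<open>{0..ts}\<close>.\<close>

lemma
  assumes Q: "prob_on_interval ts Q"
  shows pmf_mix_pmf: "pmf (mix_pmf Q) x = (\<integral>\<theta>. exp (- \<theta>) * \<theta> ^ x / fact x \<partial>Q)"
    and integrable_poisson: "integrable Q (\<lambda>\<theta>. exp (- \<theta>) * \<theta> ^ x / fact x)"
    and pmf_mix_pmf_le: "pmf (mix_pmf Q) x \<le> ts ^ x / fact x"
proof -
  note D = prob_on_intervalD[OF Q]
  interpret prob_space Q by (rule D)
  have [measurable_cong]: "sets Q = sets borel" by (rule D)
  have le: "exp (- \<theta>) * \<theta> ^ x / fact x \<le> ts ^ x / fact x" if "0 \<le> \<theta>" "\<theta> \<le> ts" for x and \<theta> :: real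
  proof -
    have "exp (- \<theta>) * \<theta> ^ x \<le> 1 * ts ^ x"
      using that by (intro mult_mono power_mono) auto
    then show ?thesis by (simp add: divide_right_mono)
  qed
  show int: "integrable Q (\<lambda>\<theta>. exp (- \<theta>) * \<theta> ^ x / fact x)" for x
    by (rule integrable_prob_on_interval[OF Q, where B = "ts ^ x / fact x"]) (use le in auto)
  have nonneg: "AE \<theta> in Q. 0 \<le> exp (- \<theta>) * \<theta> ^ x / fact x" for x
    using D(3) by eventually_elim simp
  have eq: "ennreal (\<integral>\<theta>. exp (- \<theta>) * \<theta> ^ x / fact x \<partial>Q) = (\<integral>\<^sup>+ \<theta>. ennreal (exp (- \<theta>) * \<theta> ^ x / fact x) \<partial>Q)" for x
    by (rule nn_integral_eq_integral[symmetric, OF int nonneg])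
  have "(\<integral>\<^sup>+ x. ennreal (\<integral>\<theta>. exp (- \<theta>) * \<theta> ^ x / fact x \<partial>Q) \<partial>count_space UNIV)
      = (\<Sum>x. \<integral>\<^sup>+ \<theta>. ennreal (exp (- \<theta>) * \<theta> ^ x / fact x) \<partial>Q)"
    unfolding eq by (rule nn_integral_count_space_nat)
  also have "\<dots> = (\<integral>\<^sup>+ \<theta>. (\<Sum>x. ennreal (exp (- \<theta>) * \<theta> ^ x / fact x)) \<partial>Q)"
    by (rule nn_integral_suminf[symmetric]) measurable
  also have "\<dots> = (\<integral>\<^sup>+ \<theta>. 1 \<partial>Q)"
  proof (rule nn_integral_cong_AE, use D(3) in eventually_elim)
    fix \<theta> :: real assume \<theta>: "0 \<le> \<theta> \<and> \<theta> \<le> ts"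
    have "(\<lambda>x. exp (- \<theta>) * (\<theta> ^ x /\<^sub>R fact x)) sums (exp (- \<theta>) * exp \<theta>)"
      by (intro sums_mult exp_converges)
    then have "(\<lambda>x. exp (- \<theta>) * \<theta> ^ x / fact x) sums 1"
      by (simp add: field_simps flip: exp_add)
    then show "(\<Sum>x. ennreal (exp (- \<theta>) * \<theta> ^ x / fact x)) = 1"
      using \<theta> by (subst suminf_ennreal2) (auto simp: sums_iff)
  qed
  also have "\<dots> = 1" by (simp add: emeasure_space_1)
  finally show pmf: "pmf (mix_pmf Q) x = (\<integral>\<theta>. exp (- \<theta>) * \<theta> ^ x / fact x \<partial>Q)"
    unfolding mix_pmf_def by (intro pmf_embed_pmf integral_nonneg_AE nonneg)
  show "pmf (mix_pmf Q) x \<le> ts ^ x / fact x"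
    unfolding pmf
    by (rule integral_le_const[OF int]) (use D(3) in \<open>eventually_elim, use le in auto\<close>)
qed

section \<open>Power series of the smoothed density\<close>

text \<open>The factor \<open>exp \<theta>\<close> is there to cancel
  \<open>exp (- \<theta>)\<close> of the Poisson weights. Expanding the square in the Gaussian
  exponent shows the function to be the restriction of an entire function to the real line, so
  Cauchy's inequality bounds its Taylor coefficients. The radius \<rho> is left free, to be adapted
  to the index \<open>x\<close> later.\<close>

lemma poisson_gaussian_power_series:
  fixes \<sigma> t :: real
  assumes \<sigma>: "\<sigma> > 0"
  obtains c :: "nat \<Rightarrow> real"
  where "\<And>\<theta>. (\<lambda>x. c x * \<theta> ^ x) sums (exp \<theta> * normal_density 0 \<sigma> (t - \<theta>))"
    and "\<And>x \<rho>. 0 < \<rho> \<Longrightarrow>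
      \<bar>c x\<bar> \<le> normal_density 0 \<sigma> t * exp (\<bar>t / \<sigma>\<^sup>2 + 1\<bar> * \<rho> + \<rho>\<^sup>2 / (2 * \<sigma>\<^sup>2)) / \<rho> ^ x"
proof -
  define a where "a = t / \<sigma>\<^sup>2 + 1"
  define b where "b = 1 / (2 * \<sigma>\<^sup>2)"
  define F where "F z = complex_of_real (normal_density 0 \<sigma> t) * exp (of_real a * z - of_real b * z\<^sup>2)" for z
  \<comment> \<open>Real parts turn the complex Taylor series at a real point into a real power
    series and do not increase absolute values.\<close>
  define c where "c x = Re ((deriv ^^ x) F 0 / fact x)" for x
  have hol: "F holomorphic_on S" for S
    unfolding F_def by (intro holomorphic_intros)
  have F_real: "F (of_real \<theta>) = of_real (exp \<theta> * normal_density 0 \<sigma> (t - \<theta>))" for \<theta>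
  proof -
    have "a * \<theta> - b * \<theta>\<^sup>2 - t\<^sup>2 / (2 * \<sigma>\<^sup>2) = \<theta> - (t - \<theta>)\<^sup>2 / (2 * \<sigma>\<^sup>2)"
      using \<sigma> by (simp add: a_def b_def field_simps power2_eq_square)
    then have "exp (a * \<theta> - b * \<theta>\<^sup>2) * exp (- (t\<^sup>2) / (2 * \<sigma>\<^sup>2)) = exp \<theta> * exp (- (t - \<theta>)\<^sup>2 / (2 * \<sigma>\<^sup>2))"
      by (simp flip: exp_add add: algebra_simps)
    then have "normal_density 0 \<sigma> t * exp (a * \<theta> - b * \<theta>\<^sup>2) = exp \<theta> * normal_density 0 \<sigma> (t - \<theta>)"
      by (simp add: normal_density_def field_simps)
    then show ?thesis
      by (simp add: F_def exp_of_real flip: of_real_mult of_real_power of_real_diff)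
  qed
  have Re_times_of_real: "Re (w * of_real r) = Re w * r" for w r by simp
  show thesis
  proof
    fix \<theta> :: real
    have "(\<lambda>n. (deriv ^^ n) F 0 / fact n * (of_real \<theta> - 0) ^ n) sums F (of_real \<theta>)"
      by (rule holomorphic_power_series[OF hol, where r = "\<bar>\<theta>\<bar> + 1"]) simp
    then have "(\<lambda>n. Re ((deriv ^^ n) F 0 / fact n * of_real (\<theta> ^ n))) sums Re (F (of_real \<theta>))"
      by (intro sums_Re) simp
    then show "(\<lambda>x. c x * \<theta> ^ x) sums (exp \<theta> * normal_density 0 \<sigma> (t - \<theta>))"
      unfolding F_real c_def Re_times_of_real Re_complex_of_real .
  next
    fix x :: nat and \<rho> :: real assume \<rho>: "0 < \<rho>"
    let ?B = "normal_density 0 \<sigma> t * exp (\<bar>a\<bar> * \<rho> + \<rho>\<^sup>2 / (2 * \<sigma>\<^sup>2))"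
    have "norm ((deriv ^^ x) F 0) \<le> fact x * ?B / \<rho> ^ x"
    proof (rule Cauchy_inequality[OF hol _ \<rho>])
      show "continuous_on (cball 0 \<rho>) F" by (intro holomorphic_on_imp_continuous_on hol)
      fix z :: complex assume "norm (0 - z) = \<rho>"
      then have z: "norm z = \<rho>" by simp
      have "Re (of_real a * z - of_real b * z\<^sup>2) \<le> norm (of_real a * z - of_real b * z\<^sup>2)"
        by (rule complex_Re_le_cmod)
      also have "\<dots> \<le> norm (of_real a * z) + norm (of_real b * z\<^sup>2)"
        by (rule norm_triangle_ineq4)
      also have "\<dots> = \<bar>a\<bar> * \<rho> + \<rho>\<^sup>2 / (2 * \<sigma>\<^sup>2)"
        by (simp add: norm_mult norm_divide norm_power z b_def)
      finally show "norm (F z) \<le> ?B"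
        unfolding F_def by (simp add: norm_mult mult_left_mono)
    qed
    then have "norm ((deriv ^^ x) F 0 / fact x) \<le> ?B / \<rho> ^ x"
      by (simp add: norm_divide field_simps)
    then show "\<bar>c x\<bar> \<le> normal_density 0 \<sigma> t * exp (\<bar>t / \<sigma>\<^sup>2 + 1\<bar> * \<rho> + \<rho>\<^sup>2 / (2 * \<sigma>\<^sup>2)) / \<rho> ^ x"
      unfolding c_def a_def[symmetric] by (rule order_trans[OF abs_Re_le_cmod])
  qed
qed

text \<open>Term-by-term integration of the power series against \<open>Q\<close>:
  \<open>c x * fact x\<close> times the Poisson weight is
  \<open>exp (- \<theta>) * (c x * \<theta> ^ x)\<close>, which is dominated on
  \<open>{0..ts}\<close> by \<open>\<bar>c x\<bar> * ts ^ x\<close>.\<close>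

lemma smoothed_sums:
  assumes Q: "prob_on_interval ts Q" and ts: "ts > 0"
    and c: "\<And>\<theta>. (\<lambda>x. c x * \<theta> ^ x) sums (exp \<theta> * normal_density 0 \<sigma> (t - \<theta>))"
  shows "(\<lambda>x. c x * fact x * pmf (mix_pmf Q) x) sums smoothed \<sigma> Q t"
proof -
  note D = prob_on_intervalD[OF Q]
  interpret prob_space Q by (rule D)
  have [measurable_cong]: "sets Q = sets borel" by (rule D)
  let ?f = "\<lambda>x \<theta>. c x * fact x * (exp (- \<theta>) * \<theta> ^ x / fact x)"
  have int: "integrable Q (?f x)" for x
    by (intro integrable_mult_right integrable_poisson[OF Q])
  have sm: "summable (\<lambda>x. \<bar>c x\<bar> * ts ^ x)"
  proof -
    \<comment> \<open>Convergence at the larger point \<open>ts + 1\<close> gives absolute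
      convergence at \<open>ts\<close>.\<close>
    have "summable (\<lambda>x. norm (c x * ts ^ x))"
      by (rule powser_insidea[OF sums_summable[OF c[of "ts + 1"]]]) (use ts in auto)
    then show ?thesis using ts by (simp add: abs_mult)
  qed
  have "(\<lambda>x. \<integral>\<theta>. ?f x \<theta> \<partial>Q) sums (\<integral>\<theta>. (\<Sum>x. ?f x \<theta>) \<partial>Q)"
  proof (rule sums_integral[OF int])
    show "AE \<theta> in Q. summable (\<lambda>x. norm (?f x \<theta>))"
    proof (use D(3) in eventually_elim)
      fix \<theta> :: real assume \<theta>: "0 \<le> \<theta> \<and> \<theta> \<le> ts"
      show "summable (\<lambda>x. norm (?f x \<theta>))"
      proof (rule summable_comparison_test'[OF sm, of 0])
        fix x
        have "\<bar>c x\<bar> * (exp (- \<theta>) * \<theta> ^ x) \<le> \<bar>c x\<bar> * (1 * ts ^ x)"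
          using \<theta> by (intro mult_left_mono mult_mono power_mono) auto
        then show "norm (norm (?f x \<theta>)) \<le> \<bar>c x\<bar> * ts ^ x"
          using \<theta> by (simp add: abs_mult)
      qed
    qed
    show "summable (\<lambda>x. \<integral>\<theta>. norm (?f x \<theta>) \<partial>Q)"
    proof (rule summable_comparison_test'[OF sm, of 0])
      fix x
      have "(\<integral>\<theta>. norm (?f x \<theta>) \<partial>Q) \<le> \<bar>c x\<bar> * ts ^ x"
      proof (rule integral_le_const[OF integrable_norm[OF int]], use D(3) in eventually_elim)
        fix \<theta> :: real assume \<theta>: "0 \<le> \<theta> \<and> \<theta> \<le> ts"
        have "\<bar>c x\<bar> * (exp (- \<theta>) * \<theta> ^ x) \<le> \<bar>c x\<bar> * (1 * ts ^ x)"
          using \<theta> by (intro mult_left_mono mult_mono power_mono) auto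
        then show "norm (?f x \<theta>) \<le> \<bar>c x\<bar> * ts ^ x"
          using \<theta> by (simp add: abs_mult)
      qed
      then show "norm (\<integral>\<theta>. norm (?f x \<theta>) \<partial>Q) \<le> \<bar>c x\<bar> * ts ^ x"
        by (simp del: norm_mult real_norm_def) (simp add: Bochner_Integration.integral_nonneg)
    qed
  qed
  moreover have "(\<Sum>x. ?f x \<theta>) = normal_density 0 \<sigma> (t - \<theta>)" for \<theta>
  proof -
    have "(\<lambda>x. exp (- \<theta>) * (c x * \<theta> ^ x)) sums (exp (- \<theta>) * (exp \<theta> * normal_density 0 \<sigma> (t - \<theta>)))"
      by (intro sums_mult c)
    moreover have "exp (- \<theta>) * (c x * \<theta> ^ x) = ?f x \<theta>" for x
      by simp
    moreover have "exp (- \<theta>) * (exp \<theta> * normal_density 0 \<sigma> (t - \<theta>)) = normal_density 0 \<sigma> (t - \<theta>)"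
      by (simp add: exp_minus)
    ultimately show ?thesis
      by (simp only: sums_iff)
  qed
  ultimately show ?thesis
    unfolding smoothed_def pmf_mix_pmf[OF Q] by (simp only: integral_mult_right_zero)
qed

text \<open>Triangle inequality around the mean; the central absolute moment is \<sigma> times
  \<open>sqrt (2 / pi)\<close>, and this root is at most 1.\<close>

lemma normal_abs_moment_le:
  fixes \<mu> \<sigma> :: real
  assumes \<sigma>: "\<sigma> > 0"
  shows "(\<integral>\<^sup>+ t. ennreal (\<bar>t\<bar> * normal_density \<mu> \<sigma> t) \<partial>lborel) \<le> ennreal (\<sigma> + \<bar>\<mu>\<bar>)"
proof -
  have 1: "has_bochner_integral lborel (\<lambda>t. normal_density \<mu> \<sigma> t * \<bar>t - \<mu>\<bar> ^ (2 * 0 + 1))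
      (2 ^ 0 * \<sigma> ^ (2 * 0 + 1) * fact 0 * sqrt (2 / pi))"
    by (rule normal_moment_abs_odd[OF \<sigma>])
  have 2: "has_bochner_integral lborel (normal_density \<mu> \<sigma>) 1"
    using integrable_normal_density[OF \<sigma>] integral_normal_density[OF \<sigma>]
    by (simp add: has_bochner_integral_iff)
  have 3: "has_bochner_integral lborel
      (\<lambda>t. normal_density \<mu> \<sigma> t * \<bar>t - \<mu>\<bar> + \<bar>\<mu>\<bar> * normal_density \<mu> \<sigma> t) (\<sigma> * sqrt (2 / pi) + \<bar>\<mu>\<bar> * 1)"
    using 1 by (intro has_bochner_integral_add has_bochner_integral_mult_right 2) simp
  have "(\<integral>\<^sup>+ t. ennreal (\<bar>t\<bar> * normal_density \<mu> \<sigma> t) \<partial>lborel)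
      \<le> (\<integral>\<^sup>+ t. ennreal (normal_density \<mu> \<sigma> t * \<bar>t - \<mu>\<bar> + \<bar>\<mu>\<bar> * normal_density \<mu> \<sigma> t) \<partial>lborel)"
  proof (intro nn_integral_mono ennreal_leI)
    fix t
    have "\<bar>t\<bar> * normal_density \<mu> \<sigma> t \<le> (\<bar>t - \<mu>\<bar> + \<bar>\<mu>\<bar>) * normal_density \<mu> \<sigma> t"
      by (intro mult_right_mono) auto
    then show "\<bar>t\<bar> * normal_density \<mu> \<sigma> t \<le> normal_density \<mu> \<sigma> t * \<bar>t - \<mu>\<bar> + \<bar>\<mu>\<bar> * normal_density \<mu> \<sigma> t"
      by (simp add: algebra_simps)
  qed
  also have "\<dots> = ennreal (\<sigma> * sqrt (2 / pi) + \<bar>\<mu>\<bar> * 1)"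
    using 3 by (subst nn_integral_eq_integral) (auto simp: has_bochner_integral_iff)
  also have "\<dots> \<le> ennreal (\<sigma> + \<bar>\<mu>\<bar>)"
  proof (intro ennreal_leI add_mono)
    have "sqrt (2 / pi) \<le> 1" using pi_ge_two by simp
    then show "\<sigma> * sqrt (2 / pi) \<le> \<sigma>" using \<sigma> by (simp add: mult_left_le)
  qed simp
  finally show ?thesis .
qed

text \<open>Multiplying a centred normal density by the exponential of a linear function shifts its
  mean and contributes a constant factor. The modulus of \<open>t\<close> in the exponent is
  dominated by adding the shifts to \<rho> and to \<open>- \<rho>\<close>, whose first absolute
  moments are known.\<close>

lemma normal_exp_abs_moment_le:
  fixes \<sigma> \<rho> :: real
  assumes \<sigma>: "\<sigma> > 0" and \<rho>: "\<rho> > 0"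
  shows "(\<integral>\<^sup>+ t. ennreal (\<bar>t\<bar> * (normal_density 0 \<sigma> t * exp (\<bar>t / \<sigma>\<^sup>2 + 1\<bar> * \<rho> + \<rho>\<^sup>2 / (2 * \<sigma>\<^sup>2)))) \<partial>lborel)
    \<le> ennreal (2 * (\<sigma> + \<rho>) * exp (\<rho> + \<rho>\<^sup>2 / \<sigma>\<^sup>2))"
proof -
  let ?K = "exp (\<rho> + \<rho>\<^sup>2 / \<sigma>\<^sup>2)"
  have shift: "normal_density 0 \<sigma> t * exp (s * t * \<rho> / \<sigma>\<^sup>2 + \<rho> + \<rho>\<^sup>2 / (2 * \<sigma>\<^sup>2)) = ?K * normal_density (s * \<rho>) \<sigma> t"
    if "s\<^sup>2 = 1" for s t
  proof -
    have "- (t - 0)\<^sup>2 / (2 * \<sigma>\<^sup>2) + (s * t * \<rho> / \<sigma>\<^sup>2 + \<rho> + \<rho>\<^sup>2 / (2 * \<sigma>\<^sup>2))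
        = \<rho> + (1 + s\<^sup>2) * \<rho>\<^sup>2 / (2 * \<sigma>\<^sup>2) + - (t - s * \<rho>)\<^sup>2 / (2 * \<sigma>\<^sup>2)"
      using \<sigma> by (simp add: field_simps power2_eq_square)
    also have "\<dots> = (\<rho> + \<rho>\<^sup>2 / \<sigma>\<^sup>2) + - (t - s * \<rho>)\<^sup>2 / (2 * \<sigma>\<^sup>2)"
      unfolding that by simp
    finally show ?thesis
      by (simp add: normal_density_def flip: exp_add)
  qed
  have "(\<integral>\<^sup>+ t. ennreal (\<bar>t\<bar> * (normal_density 0 \<sigma> t * exp (\<bar>t / \<sigma>\<^sup>2 + 1\<bar> * \<rho> + \<rho>\<^sup>2 / (2 * \<sigma>\<^sup>2)))) \<partial>lborel)
      \<le> (\<integral>\<^sup>+ t. ennreal ?K * ennreal (\<bar>t\<bar> * normal_density \<rho> \<sigma> t)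
            + ennreal ?K * ennreal (\<bar>t\<bar> * normal_density (- \<rho>) \<sigma> t) \<partial>lborel)"
  proof (rule nn_integral_mono)
    fix t :: real
    obtain s :: real where s: "s = 1 \<or> s = -1" and st: "s * t = \<bar>t\<bar>"
      by (cases "t \<ge> 0") (auto intro: that[of 1] that[of "-1"])
    have "\<bar>t / \<sigma>\<^sup>2 + 1\<bar> \<le> \<bar>t\<bar> / \<sigma>\<^sup>2 + 1"
      by (rule order_trans[OF abs_triangle_ineq]) simp
    then have "\<bar>t / \<sigma>\<^sup>2 + 1\<bar> * \<rho> \<le> s * t * \<rho> / \<sigma>\<^sup>2 + \<rho>"
      using mult_right_mono[of _ _ \<rho>] \<rho> unfolding st by (fastforce simp: distrib_right)
    then have "normal_density 0 \<sigma> t * exp (\<bar>t / \<sigma>\<^sup>2 + 1\<bar> * \<rho> + \<rho>\<^sup>2 / (2 * \<sigma>\<^sup>2))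
        \<le> normal_density 0 \<sigma> t * exp (s * t * \<rho> / \<sigma>\<^sup>2 + \<rho> + \<rho>\<^sup>2 / (2 * \<sigma>\<^sup>2))"
      by (intro mult_left_mono) auto
    also have "\<dots> = ?K * normal_density (s * \<rho>) \<sigma> t"
      by (rule shift) (use s in auto)
    also have "\<dots> \<le> ?K * normal_density \<rho> \<sigma> t + ?K * normal_density (- \<rho>) \<sigma> t"
      using s by auto
    finally have "\<bar>t\<bar> * (normal_density 0 \<sigma> t * exp (\<bar>t / \<sigma>\<^sup>2 + 1\<bar> * \<rho> + \<rho>\<^sup>2 / (2 * \<sigma>\<^sup>2)))
        \<le> \<bar>t\<bar> * (?K * normal_density \<rho> \<sigma> t + ?K * normal_density (- \<rho>) \<sigma> t)"
      by (intro mult_left_mono) auto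
    also have "\<dots> = ?K * (\<bar>t\<bar> * normal_density \<rho> \<sigma> t) + ?K * (\<bar>t\<bar> * normal_density (- \<rho>) \<sigma> t)"
      by (simp add: algebra_simps)
    finally have *: "\<bar>t\<bar> * (normal_density 0 \<sigma> t * exp (\<bar>t / \<sigma>\<^sup>2 + 1\<bar> * \<rho> + \<rho>\<^sup>2 / (2 * \<sigma>\<^sup>2)))
        \<le> ?K * (\<bar>t\<bar> * normal_density \<rho> \<sigma> t) + ?K * (\<bar>t\<bar> * normal_density (- \<rho>) \<sigma> t)" .
    show "ennreal (\<bar>t\<bar> * (normal_density 0 \<sigma> t * exp (\<bar>t / \<sigma>\<^sup>2 + 1\<bar> * \<rho> + \<rho>\<^sup>2 / (2 * \<sigma>\<^sup>2))))
      \<le> ennreal ?K * ennreal (\<bar>t\<bar> * normal_density \<rho> \<sigma> t)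
        + ennreal ?K * ennreal (\<bar>t\<bar> * normal_density (- \<rho>) \<sigma> t)"
      using ennreal_leI[OF *] by (simp add: ennreal_mult)
  qed
  also have "\<dots> = ennreal ?K * (\<integral>\<^sup>+ t. ennreal (\<bar>t\<bar> * normal_density \<rho> \<sigma> t) \<partial>lborel)
      + ennreal ?K * (\<integral>\<^sup>+ t. ennreal (\<bar>t\<bar> * normal_density (- \<rho>) \<sigma> t) \<partial>lborel)"
    by (simp add: nn_integral_add nn_integral_cmult)
  also have "\<dots> \<le> ennreal ?K * ennreal (\<sigma> + \<bar>\<rho>\<bar>) + ennreal ?K * ennreal (\<sigma> + \<bar>- \<rho>\<bar>)"
    by (intro add_mono mult_left_mono normal_abs_moment_le \<sigma>) auto
  also have "\<dots> = ennreal (?K * (\<sigma> + \<rho>) + ?K * (\<sigma> + \<rho>))"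
    using \<sigma> \<rho> by (simp add: ennreal_mult[symmetric] ennreal_plus[symmetric] del: ennreal_plus)
  also have "\<dots> = ennreal (2 * (\<sigma> + \<rho>) * ?K)"
    by (simp add: algebra_simps)
  finally show ?thesis .
qed

section \<open>Smoothed Wasserstein distance through the mixtures\<close>

text \<open>Stirling-type upper bound. The induction step reduces to \<open>exp 1\<close> being at
  most \<open>((x + 2) / (x + 1)) ^ (x + 2)\<close>, which is \<open>ln (1 - u) \<le> - u\<close> at
  \<open>u = 1 / (x + 2)\<close>.\<close>

lemma fact_exp_le: "fact x * exp (real x) \<le> real (x + 1) ^ (x + 1)"
proof (induction x)
  case (Suc x)
  have "1 / (real x + 2) \<le> - ln (1 - 1 / (real x + 2))"
    using ln_add_one_self_le_self2[of "- 1 / (real x + 2)"] by (simp add: field_simps)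
  also have "\<dots> = ln ((real x + 2) / (real x + 1))"
    by (subst ln_inverse[symmetric]) (auto simp: field_simps)
  finally have "1 \<le> real (x + 2) * ln ((real x + 2) / (real x + 1))"
    by (simp add: field_simps)
  then have "exp 1 \<le> exp (real (x + 2) * ln ((real x + 2) / (real x + 1)))"
    by simp
  also have "\<dots> = ((real x + 2) / (real x + 1)) ^ (x + 2)"
    by (subst exp_of_nat_mult) simp
  also have "\<dots> = real (x + 2) ^ (x + 2) / real (x + 1) ^ (x + 2)"
    by (simp add: power_divide add.commute)
  finally have e: "exp 1 * real (x + 1) ^ (x + 2) \<le> real (x + 2) ^ (x + 2)"
    by (subst (asm) pos_le_divide_eq) simp_all
  have "fact (Suc x) * exp (real (Suc x)) = exp 1 * real (x + 1) * (fact x * exp (real x))"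
    by (simp add: exp_add algebra_simps)
  also have "\<dots> \<le> exp 1 * real (x + 1) * real (x + 1) ^ (x + 1)"
    by (intro mult_left_mono Suc.IH) simp
  also have "\<dots> = exp 1 * real (x + 1) ^ (x + 2)" by simp
  also note e
  finally show ?case by (simp add: add.commute)
qed simp

text \<open>This evaluates the coefficient bound at radius
  \<open>\<sigma> * sqrt ((x + 1) / 2)\<close>. The quantity
  \<open>exp (\<rho>\<^sup>2 / \<sigma>\<^sup>2) / \<rho> ^ x\<close> is smallest at
  \<open>\<rho>\<^sup>2 = \<sigma>\<^sup>2 * x / 2\<close>; using \<open>x + 1\<close> keeps the
  radius positive at \<open>x = 0\<close>.\<close>

lemma bounded_weight:
  fixes \<sigma> :: real
  assumes \<sigma>: "\<sigma> > 0"
  obtains M where "M > 0"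
    and "\<And>x. fact x * (2 * (\<sigma> + \<sigma> * sqrt (real (x + 1) / 2)) *
      exp (\<sigma> * sqrt (real (x + 1) / 2) + real (x + 1) / 2)) / (\<sigma> * sqrt (real (x + 1) / 2)) ^ x
      \<le> M * ((2 / \<sigma>) ^ x * sqrt (fact x))"
proof -
  \<comment> \<open>What remains after the Stirling-type bound is
    \<open>(sqrt 2 / \<sigma>) ^ x * sqrt (fact x)\<close> times a subexponential factor. Enlarging
    the base to \<open>2 / \<sigma>\<close> leaves \<open>sqrt 2 ^ x\<close> in the denominator,
    which absorbs that factor.\<close>
  define w where "w x = sqrt (real (x + 1)) * (2 * (\<sigma> + \<sigma> * sqrt (real (x + 1) / 2)) *
      exp (\<sigma> * sqrt (real (x + 1) / 2) + 1 / 2)) / sqrt 2 ^ x" for x :: nat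
  have "w \<longlonglongrightarrow> 0"
    unfolding w_def using \<sigma> by real_asymp
  then have "Bseq w" by (rule convergent_imp_Bseq[OF convergentI])
  then obtain M where M: "M > 0" "\<And>x. norm (w x) \<le> M" by (auto elim: BseqE)
  show thesis
  proof (rule that[OF M(1)])
    fix x :: nat
    define n where "n = real (x + 1)"
    have n: "n > 0" by (simp add: n_def)
    have sf: "sqrt (fact x) * exp (real x / 2) \<le> sqrt n * sqrt n ^ x"
    proof -
      have "sqrt (fact x * exp (real x)) \<le> sqrt (n ^ (x + 1))"
        using fact_exp_le[of x] by (simp add: n_def)
      moreover have "sqrt (exp (real x)) = exp (real x / 2)"
        by (rule real_sqrt_unique) (simp_all flip: exp_of_nat_mult)
      ultimately show ?thesis by (simp add: real_sqrt_mult real_sqrt_power)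
    qed
    let ?P = "2 * (\<sigma> + \<sigma> * sqrt (n / 2)) * exp (\<sigma> * sqrt (n / 2) + 1 / 2)"
    have P: "?P \<ge> 0" using \<sigma> n by simp
    have "fact x * (2 * (\<sigma> + \<sigma> * sqrt (n / 2)) * exp (\<sigma> * sqrt (n / 2) + n / 2)) / (\<sigma> * sqrt (n / 2)) ^ x
        = sqrt (fact x) * (sqrt (fact x) * exp (real x / 2)) * ?P / (\<sigma> * sqrt (n / 2)) ^ x"
      by (simp add: n_def exp_add add_divide_distrib mult_ac)
    also have "\<dots> \<le> sqrt (fact x) * (sqrt n * sqrt n ^ x) * ?P / (\<sigma> * sqrt (n / 2)) ^ x"
      using \<sigma> n by (intro divide_right_mono mult_right_mono mult_left_mono sf P) auto
    also have "\<dots> = sqrt n * ?P / sqrt 2 ^ x * ((2 / \<sigma>) ^ x * sqrt (fact x))"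
    proof -
      have "(\<sigma> * sqrt (n / 2)) ^ x = \<sigma> ^ x * sqrt n ^ x / sqrt 2 ^ x"
        by (simp add: power_mult_distrib real_sqrt_divide power_divide)
      moreover have "(2::real) ^ x = sqrt 2 ^ x * sqrt 2 ^ x"
        by (simp flip: power_mult_distrib)
      moreover have "f * (m * s) * p / (u * s / r) = m * p / r * (r * r / u * f)"
        if "s \<noteq> 0" "r \<noteq> 0" "u \<noteq> 0" for f m s p u r :: real
        using that by (simp add: field_simps)
      ultimately show ?thesis
        using \<sigma> n by (simp only: power_divide) simp
    qed
    also have "\<dots> \<le> M * ((2 / \<sigma>) ^ x * sqrt (fact x))"
      using M(2)[of x] \<sigma> by (intro mult_right_mono) (auto simp: w_def n_def)
    finally show "fact x * (2 * (\<sigma> + \<sigma> * sqrt (real (x + 1) / 2)) *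
      exp (\<sigma> * sqrt (real (x + 1) / 2) + real (x + 1) / 2)) / (\<sigma> * sqrt (real (x + 1) / 2)) ^ x
      \<le> M * ((2 / \<sigma>) ^ x * sqrt (fact x))"
      by (simp only: n_def)
  qed
qed

text \<open>Both smoothed densities have expansions with the same coefficients, so their difference
  is a series in the differences of the mixture probabilities. The radius depends on
  \<open>x\<close> and not on \<open>t\<close>, so each coefficient bound can be integrated against
  \<open>\<bar>t\<bar>\<close>.\<close>

lemma W1_smooth_le_weighted_sum:
  fixes ts \<sigma> :: real
  assumes ts: "ts > 0" and \<sigma>: "\<sigma> > 0"
  obtains M where "M > 0"
    and "\<And>Q Q'. prob_on_interval ts Q \<Longrightarrow> prob_on_interval ts Q' \<Longrightarrow>
      W1_smooth \<sigma> Q Q' \<le>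
        (\<Sum>x. ennreal (M * ((2 / \<sigma>) ^ x * sqrt (fact x) * \<bar>pmf (mix_pmf Q) x - pmf (mix_pmf Q') x\<bar>)))"
proof -
  define \<rho> where "\<rho> x = \<sigma> * sqrt (real (x + 1) / 2)" for x :: nat
  have \<rho>: "\<rho> x > 0" for x using \<sigma> by (simp add: \<rho>_def)
  have \<rho>2: "(\<rho> x)\<^sup>2 / \<sigma>\<^sup>2 = real (x + 1) / 2" for x
    using \<sigma> by (simp add: \<rho>_def power_mult_distrib)
  obtain M where M: "M > 0"
    and wt: "\<And>x. fact x * (2 * (\<sigma> + \<rho> x) * exp (\<rho> x + real (x + 1) / 2)) / \<rho> x ^ x
      \<le> M * ((2 / \<sigma>) ^ x * sqrt (fact x))"
    using bounded_weight[OF \<sigma>] unfolding \<rho>_def by metis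
  show thesis
  proof (rule that[OF M])
    fix Q Q' assume Q: "prob_on_interval ts Q" and Q': "prob_on_interval ts Q'"
    define \<Delta> where "\<Delta> x = pmf (mix_pmf Q) x - pmf (mix_pmf Q') x" for x
    define m where "m x t = normal_density 0 \<sigma> t * exp (\<bar>t / \<sigma>\<^sup>2 + 1\<bar> * \<rho> x + (\<rho> x)\<^sup>2 / (2 * \<sigma>\<^sup>2))" for x t
    have m0: "m x t \<ge> 0" for x t by (simp add: m_def)
    have [measurable]: "m x \<in> borel_measurable borel" for x unfolding m_def[abs_def] by measurable
    have diff: "ennreal \<bar>smoothed \<sigma> Q t - smoothed \<sigma> Q' t\<bar> \<le> (\<Sum>x. ennreal (fact x * \<bar>\<Delta> x\<bar> / \<rho> x ^ x * m x t))" for t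
    proof -
      obtain c where c: "\<And>\<theta>. (\<lambda>x. c x * \<theta> ^ x) sums (exp \<theta> * normal_density 0 \<sigma> (t - \<theta>))"
        and cb': "\<And>x r. 0 < r \<Longrightarrow>
          \<bar>c x\<bar> \<le> normal_density 0 \<sigma> t * exp (\<bar>t / \<sigma>\<^sup>2 + 1\<bar> * r + r\<^sup>2 / (2 * \<sigma>\<^sup>2)) / r ^ x"
        by (rule poisson_gaussian_power_series[OF \<sigma>, of t]) blast
      have cb: "\<bar>c x\<bar> \<le> m x t / \<rho> x ^ x" for x
        unfolding m_def by (rule cb'[OF \<rho>])
      have "(\<lambda>x. c x * fact x * pmf (mix_pmf Q) x - c x * fact x * pmf (mix_pmf Q') x)
          sums (smoothed \<sigma> Q t - smoothed \<sigma> Q' t)"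
        by (intro sums_diff smoothed_sums[OF Q ts c] smoothed_sums[OF Q' ts c])
      then have "(\<lambda>N. \<Sum>x<N. c x * fact x * \<Delta> x) \<longlonglongrightarrow> smoothed \<sigma> Q t - smoothed \<sigma> Q' t"
        by (simp add: sums_def \<Delta>_def right_diff_distrib)
      then have "(\<lambda>N. ennreal \<bar>\<Sum>x<N. c x * fact x * \<Delta> x\<bar>) \<longlonglongrightarrow> ennreal \<bar>smoothed \<sigma> Q t - smoothed \<sigma> Q' t\<bar>"
        by (intro tendsto_ennrealI tendsto_rabs)
      then show ?thesis
      \<comment> \<open>The bound is proved for partial sums and passed to the limit, with the
        dominating series valued in \<open>ennreal\<close>, where it may be infinite.\<close>
      proof (rule LIMSEQ_le_const2, intro exI allI impI)
        fix N :: nat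
        have "\<bar>\<Sum>x<N. c x * fact x * \<Delta> x\<bar> \<le> (\<Sum>x<N. \<bar>c x * fact x * \<Delta> x\<bar>)"
          by (rule sum_abs)
        also have "\<dots> \<le> (\<Sum>x<N. fact x * \<bar>\<Delta> x\<bar> / \<rho> x ^ x * m x t)"
        proof (rule sum_mono)
          fix x
          have "\<bar>c x\<bar> * (fact x * \<bar>\<Delta> x\<bar>) \<le> m x t / \<rho> x ^ x * (fact x * \<bar>\<Delta> x\<bar>)"
            by (intro mult_right_mono cb) simp
          then show "\<bar>c x * fact x * \<Delta> x\<bar> \<le> fact x * \<bar>\<Delta> x\<bar> / \<rho> x ^ x * m x t"
            by (simp add: abs_mult mult_ac)
        qed
        finally have "ennreal \<bar>\<Sum>x<N. c x * fact x * \<Delta> x\<bar> \<le> ennreal (\<Sum>x<N. fact x * \<bar>\<Delta> x\<bar> / \<rho> x ^ x * m x t)"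
          by (rule ennreal_leI)
        also have "\<dots> = (\<Sum>x<N. ennreal (fact x * \<bar>\<Delta> x\<bar> / \<rho> x ^ x * m x t))"
          using less_imp_le[OF \<rho>] m0 by (subst sum_ennreal) simp_all
        also have "\<dots> \<le> (\<Sum>x. ennreal (fact x * \<bar>\<Delta> x\<bar> / \<rho> x ^ x * m x t))"
          by (rule sum_le_suminf) auto
        finally show "ennreal \<bar>\<Sum>x<N. c x * fact x * \<Delta> x\<bar>
          \<le> (\<Sum>x. ennreal (fact x * \<bar>\<Delta> x\<bar> / \<rho> x ^ x * m x t))" .
      qed
    qed
    have "W1_smooth \<sigma> Q Q' \<le> (\<integral>\<^sup>+ t. ennreal (\<bar>t\<bar> * \<bar>smoothed \<sigma> Q t - smoothed \<sigma> Q' t\<bar>) \<partial>lborel)"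
      unfolding W1_smooth_def convolution_gaussian[OF Q \<sigma>] convolution_gaussian[OF Q' \<sigma>]
      by (rule W1_density_le[OF borel_measurable_smoothed[OF Q \<sigma>] borel_measurable_smoothed[OF Q' \<sigma>]
            smoothed_nonneg[OF Q \<sigma>] smoothed_nonneg[OF Q' \<sigma>]
            nn_integral_smoothed[OF Q \<sigma>] nn_integral_smoothed[OF Q' \<sigma>]])
    also have "\<dots> \<le> (\<integral>\<^sup>+ t. (\<Sum>x. ennreal (fact x * \<bar>\<Delta> x\<bar> / \<rho> x ^ x) * ennreal (\<bar>t\<bar> * m x t)) \<partial>lborel)"
    proof (rule nn_integral_mono)
      fix t
      have "ennreal (\<bar>t\<bar> * \<bar>smoothed \<sigma> Q t - smoothed \<sigma> Q' t\<bar>)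
          \<le> ennreal \<bar>t\<bar> * (\<Sum>x. ennreal (fact x * \<bar>\<Delta> x\<bar> / \<rho> x ^ x * m x t))"
        unfolding ennreal_mult[OF abs_ge_zero abs_ge_zero] by (rule mult_left_mono[OF diff]) simp
      also have "\<dots> = (\<Sum>x. ennreal \<bar>t\<bar> * ennreal (fact x * \<bar>\<Delta> x\<bar> / \<rho> x ^ x * m x t))"
        by (rule ennreal_suminf_cmult[symmetric])
      also have "\<dots> = (\<Sum>x. ennreal (fact x * \<bar>\<Delta> x\<bar> / \<rho> x ^ x) * ennreal (\<bar>t\<bar> * m x t))"
        using \<rho> m0 by (intro suminf_cong)
          (simp add: ennreal_mult[symmetric] mult_ac less_imp_le del: times_divide_eq_left times_divide_eq_right)
      finally show "ennreal (\<bar>t\<bar> * \<bar>smoothed \<sigma> Q t - smoothed \<sigma> Q' t\<bar>)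
          \<le> (\<Sum>x. ennreal (fact x * \<bar>\<Delta> x\<bar> / \<rho> x ^ x) * ennreal (\<bar>t\<bar> * m x t))" .
    qed
    also have "\<dots> = (\<Sum>x. ennreal (fact x * \<bar>\<Delta> x\<bar> / \<rho> x ^ x) * (\<integral>\<^sup>+ t. ennreal (\<bar>t\<bar> * m x t) \<partial>lborel))"
      by (subst nn_integral_suminf) (auto intro!: suminf_cong nn_integral_cmult)
    also have "\<dots> \<le> (\<Sum>x. ennreal (M * ((2 / \<sigma>) ^ x * sqrt (fact x) * \<bar>\<Delta> x\<bar>)))"
    proof (rule suminf_le)
      fix x
      have "ennreal (fact x * \<bar>\<Delta> x\<bar> / \<rho> x ^ x) * (\<integral>\<^sup>+ t. ennreal (\<bar>t\<bar> * m x t) \<partial>lborel)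
          \<le> ennreal (fact x * \<bar>\<Delta> x\<bar> / \<rho> x ^ x) * ennreal (2 * (\<sigma> + \<rho> x) * exp (\<rho> x + real (x + 1) / 2))"
        unfolding m_def \<rho>2[symmetric] by (intro mult_left_mono normal_exp_abs_moment_le \<sigma> \<rho>) simp
      also have "\<dots> = ennreal (\<bar>\<Delta> x\<bar> * (fact x * (2 * (\<sigma> + \<rho> x) * exp (\<rho> x + real (x + 1) / 2)) / \<rho> x ^ x))"
        using \<rho>[of x] \<sigma> by (subst ennreal_mult[symmetric]) (auto simp: mult_ac)
      also have "\<dots> \<le> ennreal (\<bar>\<Delta> x\<bar> * (M * ((2 / \<sigma>) ^ x * sqrt (fact x))))"
        by (intro ennreal_leI mult_left_mono wt) simp
      finally show "ennreal (fact x * \<bar>\<Delta> x\<bar> / \<rho> x ^ x) * (\<integral>\<^sup>+ t. ennreal (\<bar>t\<bar> * m x t) \<partial>lborel)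
          \<le> ennreal (M * ((2 / \<sigma>) ^ x * sqrt (fact x) * \<bar>\<Delta> x\<bar>))"
        by (simp add: mult_ac)
    qed auto
    finally show "W1_smooth \<sigma> Q Q' \<le>
        (\<Sum>x. ennreal (M * ((2 / \<sigma>) ^ x * sqrt (fact x) * \<bar>pmf (mix_pmf Q) x - pmf (mix_pmf Q') x\<bar>)))"
      by (simp only: \<Delta>_def)
  qed
qed

text \<open>The ratio of consecutive terms is \<open>L / sqrt (j + 1)\<close>, at most 1/2 once
  \<open>j\<close> reaches \<open>4 * L\<^sup>2\<close>.\<close>

lemma summable_power_div_sqrt_fact:
  fixes L :: real
  assumes "L \<ge> 0"
  shows "summable (\<lambda>j. L ^ j / sqrt (fact j))"
proof (rule summable_ratio_test[of "1/2" "nat \<lceil>4 * L\<^sup>2\<rceil>"])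
  fix j :: nat assume "nat \<lceil>4 * L\<^sup>2\<rceil> \<le> j"
  then have "(2 * L)\<^sup>2 \<le> real (Suc j)" by (simp add: power_mult_distrib)
  then have "2 * L \<le> sqrt (real (Suc j))" by (rule real_le_rsqrt)
  then have "L / sqrt (real (Suc j)) \<le> 1 / 2" by (simp add: field_simps)
  then have "L / sqrt (real (Suc j)) * (L ^ j / sqrt (fact j)) \<le> 1 / 2 * (L ^ j / sqrt (fact j))"
    using assms by (intro mult_right_mono) auto
  then show "norm (L ^ Suc j / sqrt (fact (Suc j))) \<le> 1 / 2 * norm (L ^ j / sqrt (fact j))"
    using assms by (simp add: real_sqrt_mult mult_ac)
qed simp

text \<open>The weighted series is split at \<open>k\<close>. Passing to square roots in the head
  gains a factor of order \<open>sqrt (ts ^ x / fact x)\<close>, which cancels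
  \<open>sqrt (fact x)\<close> in the weight and leaves a geometric growth. The tail uses only the
  decay of the mixture probabilities. The maxima with 1 make the powers monotone in the
  exponent.\<close>

lemma W1_smooth_head_tail:
  fixes ts \<sigma> :: real
  assumes ts: "ts > 0" and \<sigma>: "\<sigma> > 0"
  obtains A where "A > 0"
    and "\<And>Q Q' k e. prob_on_interval ts Q \<Longrightarrow> prob_on_interval ts Q' \<Longrightarrow> 0 \<le> e \<Longrightarrow>
      (\<And>x. x < k \<Longrightarrow> \<bar>sqrt (pmf (mix_pmf Q) x) - sqrt (pmf (mix_pmf Q') x)\<bar> \<le> e) \<Longrightarrow>
      W1_smooth \<sigma> Q Q' \<le> ennreal (A * (real k * max 1 (2 * sqrt ts / \<sigma>) ^ k * e
        + max 1 (2 * ts / \<sigma>) ^ k / sqrt (fact k)))"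
proof -
  define S where "S = max 1 (2 * sqrt ts / \<sigma>)"
  define L where "L = max 1 (2 * ts / \<sigma>)"
  have S: "S \<ge> 1" "2 * sqrt ts / \<sigma> \<le> S" and L: "L \<ge> 1" "2 * ts / \<sigma> \<le> L"
    by (simp_all add: S_def L_def)
  define T where "T = (\<Sum>j. L ^ j / sqrt (fact j))"
  have sT: "summable (\<lambda>j. L ^ j / sqrt (fact j))"
    using L by (intro summable_power_div_sqrt_fact) simp
  have T: "T \<ge> 0" unfolding T_def using L by (intro suminf_nonneg sT) auto
  obtain M where M: "M > 0" and MW: "\<And>Q Q'. prob_on_interval ts Q \<Longrightarrow> prob_on_interval ts Q' \<Longrightarrow>
      W1_smooth \<sigma> Q Q' \<le>
        (\<Sum>x. ennreal (M * ((2 / \<sigma>) ^ x * sqrt (fact x) * \<bar>pmf (mix_pmf Q) x - pmf (mix_pmf Q') x\<bar>)))"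
    by (rule W1_smooth_le_weighted_sum[OF ts \<sigma>]) blast
  show thesis
  proof (rule that[of "M * (2 + T)"])
    show "M * (2 + T) > 0" using M T by simp
  next
    fix Q Q' and k :: nat and e :: real
    assume Q: "prob_on_interval ts Q" and Q': "prob_on_interval ts Q'" and e: "0 \<le> e"
      and close: "\<And>x. x < k \<Longrightarrow> \<bar>sqrt (pmf (mix_pmf Q) x) - sqrt (pmf (mix_pmf Q') x)\<bar> \<le> e"
    define h where "h = pmf (mix_pmf Q)"
    define h' where "h' = pmf (mix_pmf Q')"
    define a where "a x = (2 / \<sigma>) ^ x * sqrt (fact x) * \<bar>h x - h' x\<bar>" for x
    have h: "0 \<le> h x" "h x \<le> ts ^ x / fact x" "0 \<le> h' x" "h' x \<le> ts ^ x / fact x" for x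
      using pmf_mix_pmf_le[OF Q] pmf_mix_pmf_le[OF Q'] by (simp_all add: h_def h'_def)
    have fs: "fact x = sqrt (fact x) * sqrt (fact x)" for x :: nat by simp
    have a0: "a x \<ge> 0" for x using \<sigma> by (simp add: a_def)
    have aL: "a x \<le> L ^ x / sqrt (fact x)" for x
    proof -
      have "\<bar>h x - h' x\<bar> \<le> ts ^ x / fact x" using h[of x] by linarith
      then have "a x \<le> (2 / \<sigma>) ^ x * sqrt (fact x) * (ts ^ x / (sqrt (fact x) * sqrt (fact x)))"
        unfolding a_def fs[symmetric] using \<sigma> by (intro mult_left_mono) auto
      also have "\<dots> = (2 * ts / \<sigma>) ^ x / sqrt (fact x)"
        by (simp add: power_mult_distrib power_divide del: real_sqrt_mult_self)
      also have "\<dots> \<le> L ^ x / sqrt (fact x)"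
        using L ts \<sigma> by (intro divide_right_mono power_mono) auto
      finally show ?thesis .
    qed
    have sa: "summable a"
      by (rule summable_comparison_test'[OF sT, of 0]) (use a0 aL in auto)
    have head: "a x \<le> 2 * S ^ k * e" if "x < k" for x
    proof -
      have sq: "sqrt (h x) \<le> sqrt ts ^ x / sqrt (fact x)" "sqrt (h' x) \<le> sqrt ts ^ x / sqrt (fact x)"
        using real_sqrt_le_mono[OF h(2)[of x]] real_sqrt_le_mono[OF h(4)[of x]]
        by (simp_all add: real_sqrt_divide real_sqrt_power)
      \<comment> \<open>A difference of probabilities is the difference of their roots, at most
        \<open>e\<close>, times the sum of their roots, which is small by \<open>sq\<close>.\<close>
      have "h x - h' x = (sqrt (h x) - sqrt (h' x)) * (sqrt (h x) + sqrt (h' x))"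
        using h[of x] by (simp add: algebra_simps)
      then have "\<bar>h x - h' x\<bar> = \<bar>sqrt (h x) - sqrt (h' x)\<bar> * (sqrt (h x) + sqrt (h' x))"
        using h[of x] by (simp add: abs_mult)
      also have "\<dots> \<le> e * (2 * (sqrt ts ^ x / sqrt (fact x)))"
        using close[OF that] sq h[of x] e unfolding h_def[symmetric] h'_def[symmetric]
        by (intro mult_mono) auto
      finally have "a x \<le> (2 / \<sigma>) ^ x * sqrt (fact x) * (e * (2 * (sqrt ts ^ x / sqrt (fact x))))"
        unfolding a_def using \<sigma> by (intro mult_left_mono) auto
      also have "\<dots> = 2 * (2 * sqrt ts / \<sigma>) ^ x * e"
        by (simp add: power_mult_distrib power_divide)
      also have "\<dots> \<le> 2 * S ^ x * e"
        using S ts \<sigma> e by (intro mult_right_mono mult_left_mono power_mono) auto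
      also have "\<dots> \<le> 2 * S ^ k * e"
        using S that e by (intro mult_right_mono mult_left_mono power_increasing) auto
      finally show ?thesis .
    qed
    have tail: "a (j + k) \<le> L ^ k / sqrt (fact k) * (L ^ j / sqrt (fact j))" for j
    proof -
      have "fact k * fact j \<le> (fact (j + k) :: real)" by (rule fact_mult_fact_le_fact_add)
      then have "sqrt (fact k) * sqrt (fact j) \<le> sqrt (fact (j + k))"
        by (metis real_sqrt_le_mono real_sqrt_mult)
      then have "L ^ (j + k) / sqrt (fact (j + k)) \<le> L ^ (j + k) / (sqrt (fact k) * sqrt (fact j))"
        using L by (intro divide_left_mono) auto
      then show ?thesis using aL[of "j + k"] by (simp add: power_add mult_ac)
    qed
    have "(\<Sum>x. a x) = (\<Sum>j. a (j + k)) + (\<Sum>x<k. a x)"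
      by (rule suminf_split_initial_segment[OF sa])
    also have "\<dots> \<le> (\<Sum>j. L ^ k / sqrt (fact k) * (L ^ j / sqrt (fact j))) + (\<Sum>x<k. 2 * S ^ k * e)"
      by (intro add_mono suminf_le sum_mono tail head summable_ignore_initial_segment sa summable_mult sT) auto
    also have "\<dots> = L ^ k / sqrt (fact k) * T + 2 * (real k * S ^ k * e)"
      unfolding suminf_mult[OF sT] T_def by simp
    also have "\<dots> \<le> (2 + T) * (real k * S ^ k * e + L ^ k / sqrt (fact k))"
    proof -
      have comb: "v * T + 2 * u \<le> (2 + T) * (u + v)" if "0 \<le> u" "0 \<le> v" for u v
        using that T by (simp add: algebra_simps)
      show ?thesis by (rule comb) (use S L e in auto)
    qed
    finally have "(\<Sum>x. a x) \<le> (2 + T) * (real k * S ^ k * e + L ^ k / sqrt (fact k))" .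
    then have le: "M * (\<Sum>x. a x) \<le> M * (2 + T) * (real k * S ^ k * e + L ^ k / sqrt (fact k))"
      using M by simp
    have "W1_smooth \<sigma> Q Q' \<le> (\<Sum>x. ennreal (M * a x))"
      using MW[OF Q Q'] by (simp only: a_def h_def h'_def)
    also have "\<dots> = ennreal (M * (\<Sum>x. a x))"
      using M a0 by (subst suminf_ennreal2) (auto intro: summable_mult sa simp: suminf_mult[OF sa])
    also have "\<dots> \<le> ennreal (M * (2 + T) * (real k * S ^ k * e + L ^ k / sqrt (fact k)))"
      by (rule ennreal_leI[OF le])
    finally show "W1_smooth \<sigma> Q Q' \<le> ennreal (M * (2 + T) * (real k * max 1 (2 * sqrt ts / \<sigma>) ^ k * e
        + max 1 (2 * ts / \<sigma>) ^ k / sqrt (fact k)))"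
      by (simp only: S_def L_def)
  qed
qed

section \<open>Empirical distribution and chi-square divergence\<close>

text \<open>The left side squared is one term of the Hellinger series, which converges because its
  terms are at most \<open>pmf p x + pmf q x\<close>.\<close>

lemma abs_sqrt_pmf_diff_le_hellinger2:
  "\<bar>sqrt (pmf p x) - sqrt (pmf q x)\<bar> \<le> sqrt (2 * hellinger2 p q)"
proof (rule real_le_rsqrt)
  let ?f = "\<lambda>x. (sqrt (pmf p x) - sqrt (pmf q x))\<^sup>2"
  have sp: "summable (pmf r)" for r :: "nat pmf"
    using pmf_abs_summable[of r UNIV] by (simp add: abs_summable_on_nat_iff')
  have "summable ?f"
  proof (rule summable_comparison_test'[OF summable_add[OF sp[of p] sp[of q]], of 0])
    fix x
    have "?f x = pmf p x + pmf q x - 2 * (sqrt (pmf p x) * sqrt (pmf q x))"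
      by (simp add: power2_diff)
    then have "?f x \<le> pmf p x + pmf q x" by simp
    then show "norm (?f x) \<le> pmf p x + pmf q x" by simp
  qed
  then have "sum ?f {x} \<le> suminf ?f" by (intro sum_le_suminf) auto
  then show "\<bar>sqrt (pmf p x) - sqrt (pmf q x)\<bar>\<^sup>2 \<le> 2 * hellinger2 p q"
    by (simp add: hellinger2_def)
qed

lemma nn_integral_pmf_if_eq:
  assumes "a \<ge> 0" "b \<ge> 0"
  shows "(\<integral>\<^sup>+ y. ennreal (if y = x then a else b) \<partial>measure_pmf p) = ennreal (a * pmf p x + b * (1 - pmf p x))"
proof -
  have "(\<integral>\<^sup>+ y. ennreal (if y = x then a else b) \<partial>measure_pmf p)
      = (\<integral>\<^sup>+ y. ennreal a * indicator {x} y + ennreal b * indicator (- {x}) y \<partial>measure_pmf p)"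
    by (intro nn_integral_cong) (auto simp: indicator_def)
  also have "\<dots> = ennreal a * emeasure (measure_pmf p) {x} + ennreal b * emeasure (measure_pmf p) (- {x})"
    by (simp add: nn_integral_add nn_integral_cmult)
  also have "emeasure (measure_pmf p) (- {x}) = ennreal (1 - pmf p x)"
    using measure_pmf.prob_compl[of "{x}" p]
    by (simp add: measure_pmf.emeasure_eq_measure measure_pmf_single Compl_eq_Diff_UNIV)
  finally show ?thesis
    using assms by (simp add: emeasure_pmf_single pmf_le_1 ennreal_mult)
qed

text \<open>The shift \<open>c\<close> is there for the induction: the first observation displaces the deviation
  of the remaining sample by a constant.\<close>

lemma nn_integral_count_deviation_sq:
  "(\<integral>\<^sup>+ xs. ennreal ((real (count (mset xs) x) - real n * pmf p x + c)\<^sup>2) \<partial>measure_pmf (replicate_pmf n p))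
    = ennreal (real n * (pmf p x * (1 - pmf p x)) + c\<^sup>2)"
proof (induction n arbitrary: c)
  case (Suc n)
  let ?q = "pmf p x" and ?V = "real n * (pmf p x * (1 - pmf p x))"
  have V: "?V \<ge> 0" by (simp add: pmf_le_1)
  have "(\<integral>\<^sup>+ xs. ennreal ((real (count (mset xs) x) - real (Suc n) * ?q + c)\<^sup>2) \<partial>measure_pmf (replicate_pmf (Suc n) p))
      = (\<integral>\<^sup>+ y. \<integral>\<^sup>+ xs. ennreal ((real (count (mset xs) x) - real n * ?q + ((if y = x then 1 else 0) - ?q + c))\<^sup>2)
          \<partial>measure_pmf (replicate_pmf n p) \<partial>measure_pmf p)"
    by (simp, intro nn_integral_cong) (simp add: algebra_simps)
  also have "\<dots> = (\<integral>\<^sup>+ y. ennreal (if y = x then ?V + (1 - ?q + c)\<^sup>2 else ?V + (c - ?q)\<^sup>2) \<partial>measure_pmf p)"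
    unfolding Suc.IH by (intro nn_integral_cong) auto
  also have "\<dots> = ennreal ((?V + (1 - ?q + c)\<^sup>2) * ?q + (?V + (c - ?q)\<^sup>2) * (1 - ?q))"
    using V by (intro nn_integral_pmf_if_eq) auto
  \<comment> \<open>The centred indicator of the first observation has mean zero, so its cross term
    with \<open>c\<close> vanishes and only its variance is added.\<close>
  also have "(?V + (1 - ?q + c)\<^sup>2) * ?q + (?V + (c - ?q)\<^sup>2) * (1 - ?q) = real (Suc n) * (?q * (1 - ?q)) + c\<^sup>2"
    by (simp add: algebra_simps power2_eq_square)
  finally show ?case .
qed simp

lemma pmf_empirical:
  assumes "xs \<noteq> []"
  shows "pmf (empirical xs) x = real (count (mset xs) x) / real (length xs)"
  using assms by (simp add: empirical_def pmf_of_multiset)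

text \<open>Points outside the support of \<open>p\<close> contribute \<open>x / 0 = 0\<close>; they are never observed.\<close>

definition truncated_chi2 :: "nat \<Rightarrow> nat pmf \<Rightarrow> nat pmf \<Rightarrow> real" where
  "truncated_chi2 k q p = (\<Sum>x<k. (pmf q x - pmf p x)\<^sup>2 / pmf p x)"

lemma truncated_chi2_nonneg: "0 \<le> truncated_chi2 k q p"
  by (simp add: truncated_chi2_def sum_nonneg)

text \<open>Each of the \<open>k\<close> terms is the variance of an empirical frequency divided by
  the probability, hence at most \<open>1 / n\<close>, however small that probability is.\<close>

lemma nn_integral_truncated_chi2_le:
  assumes n: "n > 0"
  shows "(\<integral>\<^sup>+ xs. ennreal (truncated_chi2 k (empirical xs) p) \<partial>measure_pmf (replicate_pmf n p))
    \<le> ennreal (real k / real n)"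
proof -
  let ?R = "measure_pmf (replicate_pmf n p)"
  have "(\<integral>\<^sup>+ xs. ennreal (truncated_chi2 k (empirical xs) p) \<partial>?R)
      = (\<Sum>x<k. \<integral>\<^sup>+ xs. ennreal ((pmf (empirical xs) x - pmf p x)\<^sup>2 / pmf p x) \<partial>?R)"
    unfolding truncated_chi2_def by (subst nn_integral_sum[symmetric]) auto
  also have "\<dots> \<le> (\<Sum>x<k. ennreal (1 / real n))"
  proof (rule sum_mono)
    fix x
    show "(\<integral>\<^sup>+ xs. ennreal ((pmf (empirical xs) x - pmf p x)\<^sup>2 / pmf p x) \<partial>?R) \<le> ennreal (1 / real n)"
    proof (cases "pmf p x = 0")
      case False
      then have q: "pmf p x > 0" by (simp add: pmf_pos)
      have "(\<integral>\<^sup>+ xs. ennreal ((pmf (empirical xs) x - pmf p x)\<^sup>2 / pmf p x) \<partial>?R)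
          = (\<integral>\<^sup>+ xs. ennreal (1 / (real n ^ 2 * pmf p x)) *
              ennreal ((real (count (mset xs) x) - real n * pmf p x + 0)\<^sup>2) \<partial>?R)"
      proof (rule nn_integral_cong_AE, rule AE_pmfI)
        fix xs assume "xs \<in> set_pmf (replicate_pmf n p)"
        then have xs: "length xs = n" by (simp add: set_replicate_pmf)
        then have c: "real (count (mset xs) x) = real n * pmf (empirical xs) x"
          using n by (subst pmf_empirical) auto
        have "(pmf (empirical xs) x - pmf p x)\<^sup>2 / pmf p x
            = 1 / (real n ^ 2 * pmf p x) * (real (count (mset xs) x) - real n * pmf p x + 0)\<^sup>2"
          unfolding c using n q by (simp add: field_simps power2_eq_square)
        then show "ennreal ((pmf (empirical xs) x - pmf p x)\<^sup>2 / pmf p x)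
          = ennreal (1 / (real n ^ 2 * pmf p x)) * ennreal ((real (count (mset xs) x) - real n * pmf p x + 0)\<^sup>2)"
          by (simp add: ennreal_mult[symmetric])
      qed
      also have "\<dots> = ennreal (1 / (real n ^ 2 * pmf p x)) * ennreal (real n * (pmf p x * (1 - pmf p x)) + 0\<^sup>2)"
        unfolding nn_integral_count_deviation_sq[symmetric] by (rule nn_integral_cmult) simp
      also have "\<dots> = ennreal ((1 - pmf p x) / real n)"
        using n q by (simp add: ennreal_mult[symmetric] pmf_le_1 field_simps power2_eq_square)
      also have "\<dots> \<le> ennreal (1 / real n)"
        by (intro ennreal_leI divide_right_mono) auto
      finally show ?thesis .
    qed simp
  qed
  also have "\<dots> = ennreal (real k / real n)"
    by (subst sum_ennreal) auto
  finally show ?thesis .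
qed

text \<open>No observation reaches \<open>k\<close>, so a term at \<open>x \<ge> k\<close> reduces
  to \<open>pmf p x\<close>, and these add up to the tail mass. The support condition excludes the
  infinite branch of \<open>chi2\<close>.\<close>

lemma chi2_empirical_le:
  assumes xs: "xs \<noteq> []" and k: "\<And>y. y \<in> set xs \<Longrightarrow> y < k" and supp: "set xs \<subseteq> set_pmf p"
  shows "chi2 (empirical xs) p \<le> ennreal (truncated_chi2 k (empirical xs) p + measure (measure_pmf p) {k..})"
proof -
  have zero: "pmf (empirical xs) x = 0" if "x \<notin> set xs" for x
    using xs that by (simp add: pmf_empirical count_eq_zero_iff)
  let ?g = "\<lambda>x. if pmf p x = 0 then (if pmf (empirical xs) x = 0 then 0 else \<infinity>)
                        else ennreal ((pmf (empirical xs) x - pmf p x)^2 / pmf p x)"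
  have g: "?g x = ennreal ((pmf (empirical xs) x - pmf p x)^2 / pmf p x)" for x
  proof (cases "pmf p x = 0")
    case True
    then have "x \<notin> set xs" using supp by (auto simp: set_pmf_iff)
    then show ?thesis using True zero by simp
  qed simp
  have "chi2 (empirical xs) p = (\<integral>\<^sup>+ x. ennreal ((pmf (empirical xs) x - pmf p x)^2 / pmf p x) \<partial>count_space UNIV)"
    unfolding chi2_def g ..
  also have "\<dots> \<le> (\<integral>\<^sup>+ x. ennreal ((pmf (empirical xs) x - pmf p x)^2 / pmf p x) * indicator {..<k} x
      + ennreal (pmf p x) * indicator {k..} x \<partial>count_space UNIV)"
  proof (rule nn_integral_mono)
    fix x
    show "ennreal ((pmf (empirical xs) x - pmf p x)^2 / pmf p x)
      \<le> ennreal ((pmf (empirical xs) x - pmf p x)^2 / pmf p x) * indicator {..<k} x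
        + ennreal (pmf p x) * indicator {k..} x"
    proof (cases "x < k")
      case False
      then have "pmf (empirical xs) x = 0" using k zero by auto
      then show ?thesis using False by (auto simp: power2_eq_square)
    qed simp
  qed
  also have "\<dots> = (\<integral>\<^sup>+ x\<in>{..<k}. ennreal ((pmf (empirical xs) x - pmf p x)^2 / pmf p x) \<partial>count_space UNIV)
      + (\<integral>\<^sup>+ x\<in>{k..}. ennreal (pmf p x) \<partial>count_space UNIV)"
    by (rule nn_integral_add) auto
  also have "(\<integral>\<^sup>+ x\<in>{..<k}. ennreal ((pmf (empirical xs) x - pmf p x)^2 / pmf p x) \<partial>count_space UNIV)
      = ennreal (truncated_chi2 k (empirical xs) p)"
    unfolding truncated_chi2_def
    by (subst nn_integral_count_space_indicator[symmetric])
      (auto simp: nn_integral_count_space_finite intro!: sum_ennreal)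
  also have "(\<integral>\<^sup>+ x\<in>{k..}. ennreal (pmf p x) \<partial>count_space UNIV) = ennreal (measure (measure_pmf p) {k..})"
    by (subst nn_integral_count_space_indicator[symmetric])
      (auto simp: nn_integral_pmf measure_pmf.emeasure_eq_measure)
  finally show ?thesis
    by (simp add: truncated_chi2_nonneg)
qed

text \<open>Union bound over the observations, by induction on the sample size.\<close>

lemma nn_integral_exists_ge_le:
  fixes p :: "nat pmf"
  shows "(\<integral>\<^sup>+ xs. ennreal (if \<exists>y\<in>set xs. k \<le> y then 1 else 0) \<partial>measure_pmf (replicate_pmf n p))
    \<le> ennreal (real n * measure (measure_pmf p) {k..})"
proof (induction n)
  case (Suc n)
  let ?\<tau> = "measure (measure_pmf p) {k..}"
  have "(\<integral>\<^sup>+ xs. ennreal (if \<exists>y\<in>set xs. k \<le> y then 1 else 0) \<partial>measure_pmf (replicate_pmf (Suc n) p))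
      = (\<integral>\<^sup>+ y. \<integral>\<^sup>+ xs. ennreal (if k \<le> y \<or> (\<exists>y\<in>set xs. k \<le> y) then 1 else 0) \<partial>measure_pmf (replicate_pmf n p) \<partial>measure_pmf p)"
    by simp
  also have "\<dots> \<le> (\<integral>\<^sup>+ y. \<integral>\<^sup>+ xs. indicator {k..} y + ennreal (if \<exists>y\<in>set xs. k \<le> y then 1 else 0)
      \<partial>measure_pmf (replicate_pmf n p) \<partial>measure_pmf p)"
    by (intro nn_integral_mono) (auto simp: indicator_def)
  also have "\<dots> = ennreal ?\<tau> + (\<integral>\<^sup>+ xs. ennreal (if \<exists>y\<in>set xs. k \<le> y then 1 else 0) \<partial>measure_pmf (replicate_pmf n p))"
    by (simp add: nn_integral_add measure_pmf.emeasure_eq_measure)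
  also have "\<dots> \<le> ennreal ?\<tau> + ennreal (real n * ?\<tau>)"
    by (intro add_left_mono Suc.IH)
  also have "\<dots> = ennreal (real (Suc n) * ?\<tau>)"
    by (simp add: algebra_simps flip: ennreal_plus)
  finally show ?case .
qed simp

lemma mix_pmf_tail_le:
  assumes ts: "ts > 0" and Q: "prob_on_interval ts Q"
  shows "measure (measure_pmf (mix_pmf Q)) {k..} \<le> exp ts * ts ^ k / fact k"
proof -
  have "ennreal (measure (measure_pmf (mix_pmf Q)) {k..}) = (\<integral>\<^sup>+ x. ennreal (pmf (mix_pmf Q) x) \<partial>count_space {k..})"
    by (simp add: nn_integral_pmf measure_pmf.emeasure_eq_measure)
  also have "\<dots> = (\<integral>\<^sup>+ j. ennreal (pmf (mix_pmf Q) (j + k)) \<partial>count_space UNIV)"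
    by (rule nn_integral_bij_count_space[symmetric])
      (rule bij_betwI[of _ _ _ "\<lambda>x. x - k"]; auto)
  also have "\<dots> \<le> (\<integral>\<^sup>+ j. ennreal (ts ^ k / fact k * (ts ^ j /\<^sub>R fact j)) \<partial>count_space UNIV)"
  proof (intro nn_integral_mono ennreal_leI)
    fix j
    have "ts ^ (j + k) / fact (j + k) \<le> ts ^ (j + k) / (fact k * fact j)"
      using ts by (intro divide_left_mono fact_mult_fact_le_fact_add) auto
    also have "\<dots> = ts ^ k / fact k * (ts ^ j /\<^sub>R fact j)"
      by (simp add: power_add field_simps)
    finally show "pmf (mix_pmf Q) (j + k) \<le> ts ^ k / fact k * (ts ^ j /\<^sub>R fact j)"
      using pmf_mix_pmf_le[OF Q, of "j + k"] by linarith
  qed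
  also have "\<dots> = ennreal (ts ^ k / fact k * exp ts)"
  proof -
    have "(\<lambda>j. ts ^ k / fact k * (ts ^ j /\<^sub>R fact j)) sums (ts ^ k / fact k * exp ts)"
      by (intro sums_mult exp_converges)
    then show ?thesis
      using ts by (subst nn_integral_count_space_nat, subst suminf_ennreal2) (auto simp: sums_iff)
  qed
  finally show ?thesis
    using ts by (subst (asm) ennreal_le_iff) (auto simp: mult.commute)
qed

section \<open>Risk bound for a fixed truncation level\<close>

text \<open>Arithmetic-geometric mean inequality. It makes the risk bound linear in the truncated
  chi-square divergence, whose expectation is known.\<close>

lemma two_sqrt_le:
  fixes y s :: real
  assumes "y \<ge> 0" "s > 0"
  shows "2 * sqrt y \<le> s * y + 1 / s"
proof -
  have "0 \<le> (s * sqrt y - 1)\<^sup>2 / s" using assms by simp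
  also have "\<dots> = s * (sqrt y)\<^sup>2 + 1 / s - 2 * sqrt y"
    using assms(2) by (simp add: field_simps power2_eq_square del: real_sqrt_mult_self)
  finally show ?thesis using assms(1) by simp
qed

text \<open>Triangle inequality through the empirical distribution. The truth is within
  \<open>\<gamma>4 * chi2\<close> of it and the estimator is no farther by minimality; the factor 2
  counts these two comparisons.\<close>

lemma sqrt_mix_pmf_diff_le:
  assumes \<gamma>: "\<gamma>3 > 0" "\<gamma>4 > 0"
    and lower: "\<And>p q. \<gamma>3 * hellinger2 p q \<le> d p q"
    and upper: "\<And>p q. ennreal (d p q) \<le> ennreal \<gamma>4 * chi2 p q"
    and est: "is_min_dist_estimator ts d Qhat"
    and Q: "prob_on_interval ts Q" and xs: "xs \<noteq> []" "set xs \<subseteq> set_pmf (mix_pmf Q)"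
    and k: "\<And>y. y \<in> set xs \<Longrightarrow> y < k"
    and \<tau>: "measure (measure_pmf (mix_pmf Q)) {k..} \<le> \<tau>"
  shows "\<bar>sqrt (pmf (mix_pmf Q) x) - sqrt (pmf (mix_pmf (Qhat xs)) x)\<bar>
    \<le> sqrt (2 * \<gamma>4 / \<gamma>3) * (2 * sqrt (truncated_chi2 k (empirical xs) (mix_pmf Q) + \<tau>))"
proof -
  let ?y = "truncated_chi2 k (empirical xs) (mix_pmf Q) + \<tau>"
  have y0: "0 \<le> ?y"
    using truncated_chi2_nonneg[of k "empirical xs" "mix_pmf Q"] \<tau>
      measure_nonneg[of "measure_pmf (mix_pmf Q)" "{k..}"] by linarith
  have "chi2 (empirical xs) (mix_pmf Q) \<le> ennreal ?y"
    by (rule order_trans[OF chi2_empirical_le[OF xs(1) k xs(2)]]) (use \<tau> in \<open>auto intro: ennreal_leI\<close>)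
  then have "ennreal (d (empirical xs) (mix_pmf Q)) \<le> ennreal \<gamma>4 * ennreal ?y"
    by (intro order_trans[OF upper] mult_left_mono) auto
  also have "\<dots> = ennreal (\<gamma>4 * ?y)"
    using \<gamma> y0 by (simp add: ennreal_mult del: ennreal_plus)
  finally have d: "d (empirical xs) (mix_pmf Q) \<le> \<gamma>4 * ?y"
    using \<gamma> y0 by (subst (asm) ennreal_le_iff) auto
  have d': "d (empirical xs) (mix_pmf (Qhat xs)) \<le> \<gamma>4 * ?y"
    using est xs(1) Q d unfolding is_min_dist_estimator_def by (meson order_trans)
  have close: "\<bar>sqrt (pmf (empirical xs) x) - sqrt (pmf q x)\<bar> \<le> sqrt (2 * \<gamma>4 / \<gamma>3) * sqrt ?y"
    if "d (empirical xs) q \<le> \<gamma>4 * ?y" for q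
  proof -
    have "\<gamma>3 * hellinger2 (empirical xs) q \<le> \<gamma>4 * ?y"
      using lower that by (rule order_trans)
    then have "2 * hellinger2 (empirical xs) q \<le> 2 * \<gamma>4 / \<gamma>3 * ?y"
      using \<gamma> by (simp add: field_simps)
    then have "sqrt (2 * hellinger2 (empirical xs) q) \<le> sqrt (2 * \<gamma>4 / \<gamma>3 * ?y)"
      by (rule real_sqrt_le_mono)
    then show ?thesis
      using abs_sqrt_pmf_diff_le_hellinger2[of "empirical xs" x q] unfolding real_sqrt_mult by linarith
  qed
  show ?thesis
    using close[OF d] close[OF d'] by linarith
qed

text \<open>Two cases: if every observation is below \<open>k\<close>, the head-tail bound applies
  with the Hellinger estimate; otherwise a constant bound is multiplied by the probability of this
  event. \<open>A\<close> is chosen before \<open>d\<close>, \<open>Qhat\<close>, \<open>n\<close>,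
  \<open>k\<close> and \<open>Q\<close>, which makes the bound uniform in them.\<close>

lemma min_dist_W1_risk:
  fixes ts \<sigma> \<gamma>3 \<gamma>4 :: real
  assumes ts: "ts > 0" and \<sigma>: "\<sigma> > 0" and \<gamma>: "\<gamma>3 > 0" "\<gamma>4 > 0"
  obtains A where "A > 0"
    and "\<And>d Qhat n k Q. (\<And>p q. \<gamma>3 * hellinger2 p q \<le> d p q) \<Longrightarrow>
      (\<And>p q. ennreal (d p q) \<le> ennreal \<gamma>4 * chi2 p q) \<Longrightarrow>
      is_min_dist_estimator ts d Qhat \<Longrightarrow> n > 0 \<Longrightarrow> prob_on_interval ts Q \<Longrightarrow>
      (\<integral>\<^sup>+ xs. W1_smooth \<sigma> Q (Qhat xs) \<partial>measure_pmf (replicate_pmf n (mix_pmf Q)))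
        \<le> ennreal (A * (real k * max 1 (2 * sqrt ts / \<sigma>) ^ k *
              (sqrt n * (real k / real n + exp ts * ts ^ k / fact k) + 1 / sqrt n)
            + max 1 (2 * ts / \<sigma>) ^ k / sqrt (fact k) + real n * (exp ts * ts ^ k / fact k)))"
proof -
  define S where "S = max 1 (2 * sqrt ts / \<sigma>)"
  define L where "L = max 1 (2 * ts / \<sigma>)"
  define G where "G = sqrt (2 * \<gamma>4 / \<gamma>3)"
  have S: "S \<ge> 1" and L: "L \<ge> 1" and G: "G \<ge> 0"
    using \<gamma> by (simp_all add: S_def L_def G_def)
  obtain A where A: "A > 0"
    and W: "\<And>Q Q' k e. prob_on_interval ts Q \<Longrightarrow> prob_on_interval ts Q' \<Longrightarrow> 0 \<le> e \<Longrightarrow>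
      (\<And>x. x < k \<Longrightarrow> \<bar>sqrt (pmf (mix_pmf Q) x) - sqrt (pmf (mix_pmf Q') x)\<bar> \<le> e) \<Longrightarrow>
      W1_smooth \<sigma> Q Q' \<le> ennreal (A * (real k * S ^ k * e + L ^ k / sqrt (fact k)))"
    unfolding S_def L_def by (rule W1_smooth_head_tail[OF ts \<sigma>]) blast
  show thesis
  proof (rule that[of "A * (1 + G)"])
    show "A * (1 + G) > 0" using A G by simp
  next
    fix d Qhat and n k :: nat and Q
    assume lower: "\<And>p q. \<gamma>3 * hellinger2 p q \<le> d p q"
      and upper: "\<And>p q. ennreal (d p q) \<le> ennreal \<gamma>4 * chi2 p q"
      and est: "is_min_dist_estimator ts d Qhat" and n: "n > 0" and Q: "prob_on_interval ts Q"
    let ?p = "mix_pmf Q" and ?R = "measure_pmf (replicate_pmf n (mix_pmf Q))"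
    define \<tau> where "\<tau> = exp ts * ts ^ k / fact k"
    have \<tau>0: "\<tau> \<ge> 0" using ts by (simp add: \<tau>_def)
    have \<tau>: "measure (measure_pmf ?p) {k..} \<le> \<tau>"
      unfolding \<tau>_def by (rule mix_pmf_tail_le[OF ts Q])
    define Y where "Y xs = truncated_chi2 k (empirical xs) ?p" for xs
    define bad where "bad xs = (if \<exists>y\<in>set xs. k \<le> y then 1 else (0::real))" for xs
    \<comment> \<open>\<open>b\<close> and \<open>a\<close> are the slope and intercept in the
      divergence \<open>Y\<close> once its square root has been linearised.\<close>
    define b where "b = A * (real k * S ^ k * (G * sqrt n))"
    define a where "a = A * (real k * S ^ k * (G * (sqrt n * \<tau> + 1 / sqrt n)) + L ^ k / sqrt (fact k))"
    have Y0: "Y xs \<ge> 0" for xs by (simp add: Y_def truncated_chi2_nonneg)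
    have b0: "b \<ge> 0" using A S G by (simp add: b_def)
    have a0: "a \<ge> 0" using A S G L \<tau>0 by (simp add: a_def)
    have pointwise: "W1_smooth \<sigma> Q (Qhat xs) \<le> ennreal a + ennreal b * ennreal (Y xs) + ennreal A * ennreal (bad xs)"
      if xs: "xs \<in> set_pmf (replicate_pmf n ?p)" for xs
    proof -
      have ne: "xs \<noteq> []" and supp: "set xs \<subseteq> set_pmf ?p"
        using xs n by (auto simp: set_replicate_pmf)
      have Qh: "prob_on_interval ts (Qhat xs)"
        using est ne by (simp add: is_min_dist_estimator_def)
      show ?thesis
      proof (cases "\<exists>y\<in>set xs. k \<le> y")
        case True
        have "W1_smooth \<sigma> Q (Qhat xs) \<le> ennreal A"
          \<comment> \<open>Truncation at 0 leaves no head, and the tail term is 1.\<close>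
          using W[OF Q Qh, of 0 0] by simp
        also have "\<dots> = ennreal A * ennreal (bad xs)" using True by (simp add: bad_def)
        also have "\<dots> \<le> ennreal a + ennreal b * ennreal (Y xs) + ennreal A * ennreal (bad xs)"
          by (rule le_iff_add[THEN iffD2]) (auto simp: add.commute)
        finally show ?thesis .
      next
        case False
        let ?e = "G * (2 * sqrt (Y xs + \<tau>))"
        have "W1_smooth \<sigma> Q (Qhat xs) \<le> ennreal (A * (real k * S ^ k * ?e + L ^ k / sqrt (fact k)))"
        proof (rule W[OF Q Qh])
          show "0 \<le> ?e" using G Y0[of xs] \<tau>0 by simp
          fix x
          show "\<bar>sqrt (pmf ?p x) - sqrt (pmf (mix_pmf (Qhat xs)) x)\<bar> \<le> ?e"
            unfolding Y_def G_def
            by (rule sqrt_mix_pmf_diff_le[OF \<gamma> lower upper est Q ne supp _ \<tau>]) (use False in auto)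
        qed
        \<comment> \<open>Linearisation with parameter \<open>sqrt n\<close>, which balances a
          divergence of order \<open>1 / n\<close> against the constant term
          \<open>1 / sqrt n\<close>.\<close>
        also have "\<dots> \<le> ennreal (A * (real k * S ^ k * (G * (sqrt n * (Y xs + \<tau>) + 1 / sqrt n)) + L ^ k / sqrt (fact k)))"
          using A S G n Y0[of xs] \<tau>0
          by (intro ennreal_leI mult_left_mono add_right_mono two_sqrt_le) auto
        also have "\<dots> = ennreal (a + b * Y xs)"
          by (simp add: a_def b_def algebra_simps)
        also have "\<dots> = ennreal a + ennreal b * ennreal (Y xs) + ennreal A * ennreal (bad xs)"
          using a0 b0 Y0[of xs] False by (simp add: bad_def ennreal_mult)
        finally show ?thesis .
      qed
    qed
    have "(\<integral>\<^sup>+ xs. W1_smooth \<sigma> Q (Qhat xs) \<partial>?R)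
        \<le> (\<integral>\<^sup>+ xs. ennreal a + ennreal b * ennreal (Y xs) + ennreal A * ennreal (bad xs) \<partial>?R)"
      by (intro nn_integral_mono_AE AE_pmfI pointwise)
    also have "\<dots> = ennreal a + ennreal b * (\<integral>\<^sup>+ xs. ennreal (Y xs) \<partial>?R) + ennreal A * (\<integral>\<^sup>+ xs. ennreal (bad xs) \<partial>?R)"
      by (simp add: nn_integral_add nn_integral_cmult)
    also have "\<dots> \<le> ennreal a + ennreal b * ennreal (real k / real n) + ennreal A * ennreal (real n * \<tau>)"
    proof (intro add_mono mult_left_mono order_refl)
      show "(\<integral>\<^sup>+ xs. ennreal (Y xs) \<partial>?R) \<le> ennreal (real k / real n)"
        unfolding Y_def by (rule nn_integral_truncated_chi2_le[OF n])
      show "(\<integral>\<^sup>+ xs. ennreal (bad xs) \<partial>?R) \<le> ennreal (real n * \<tau>)"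
        unfolding bad_def
        by (rule order_trans[OF nn_integral_exists_ge_le]) (intro ennreal_leI mult_left_mono \<tau>, simp)
    qed auto
    also have "\<dots> = ennreal (a + b * (real k / real n) + A * (real n * \<tau>))"
      using a0 b0 A \<tau>0 by (simp add: ennreal_mult[symmetric] ennreal_plus[symmetric] del: ennreal_plus)
    also have "\<dots> \<le> ennreal (A * (1 + G) * (real k * S ^ k * (sqrt n * (real k / real n + \<tau>) + 1 / sqrt n)
            + L ^ k / sqrt (fact k) + real n * \<tau>))"
    proof (rule ennreal_leI)
      define u where "u = real k * S ^ k * (sqrt n * (real k / real n + \<tau>) + 1 / sqrt n)"
      define v where "v = L ^ k / sqrt (fact k)"
      define w where "w = real n * \<tau>"
      have nn: "0 \<le> u" "0 \<le> v" "0 \<le> w"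
        using S L \<tau>0 by (simp_all add: u_def v_def w_def)
      have "a + b * (real k / real n) + A * (real n * \<tau>) = A * (G * u + v + w)"
        by (simp add: a_def b_def u_def v_def w_def algebra_simps)
      also have "\<dots> \<le> A * ((1 + G) * (u + v + w))"
        using A G nn by (intro mult_left_mono) (simp_all add: algebra_simps)
      finally show "a + b * (real k / real n) + A * (real n * \<tau>)
          \<le> A * (1 + G) * (real k * S ^ k * (sqrt n * (real k / real n + \<tau>) + 1 / sqrt n)
            + L ^ k / sqrt (fact k) + real n * \<tau>)"
        by (simp add: u_def v_def w_def mult.assoc)
    qed
    finally show "(\<integral>\<^sup>+ xs. W1_smooth \<sigma> Q (Qhat xs) \<partial>?R)
        \<le> ennreal (A * (1 + G) * (real k * max 1 (2 * sqrt ts / \<sigma>) ^ k *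
              (sqrt n * (real k / real n + exp ts * ts ^ k / fact k) + 1 / sqrt n)
            + max 1 (2 * ts / \<sigma>) ^ k / sqrt (fact k) + real n * (exp ts * ts ^ k / fact k)))"
      by (simp only: S_def L_def \<tau>_def)
  qed
qed

section \<open>Choice of the truncation level\<close>

text \<open>With this choice \<open>k * ln k\<close> is asymptotically \<open>8 * ln n\<close>, so
  \<open>sqrt (fact k)\<close> grows like \<open>n\<close> to a power tending to 4, more than is
  needed, while \<open>S ^ k\<close> is only \<open>n\<close> to the power
  \<open>8 * ln S / ln (ln n)\<close>, up to rounding.\<close>

definition cutoff :: "nat \<Rightarrow> nat" where
  "cutoff n = nat \<lceil>8 * ln (real n) / ln (ln (real n))\<rceil>"

text \<open>The single term \<open>k ^ k / fact k\<close> of the exponential series is at most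
  \<open>exp k\<close>.\<close>

lemma ln_fact_ge: "real k * ln (real k) - real k \<le> ln (fact k)"
proof (cases "k = 0")
  case False
  have "(real k) ^ k /\<^sub>R fact k \<le> exp (real k)"
    using sum_le_suminf[OF summable_exp_generic[of "real k"], of "{k}"]
    by (simp add: exp_def)
  then have "(real k) ^ k \<le> exp (real k) * fact k"
    by (simp add: field_simps)
  then have "ln ((real k) ^ k) \<le> ln (exp (real k) * fact k)"
    using False by (subst ln_le_cancel_iff) auto
  then show ?thesis
    using False by (simp add: ln_realpow ln_mult)
qed simp

text \<open>In logarithms this is the bound \<open>ln_fact_ge\<close> at the cutoff. The exponent
  -3/2 leaves order \<open>n\<close> to the -1/2 after the tail mass is multiplied by
  \<open>n\<close> in the union bound.\<close>

lemma eventually_power_cutoff_div_sqrt_fact_le: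
  fixes L :: real
  assumes L: "L \<ge> 1"
  shows "eventually (\<lambda>n. L ^ cutoff n / sqrt (fact (cutoff n)) \<le> real n powr (- 3 / 2)) sequentially"
proof -
  let ?v = "\<lambda>n::nat. 8 * ln (real n) / ln (ln (real n))"
  have 1: "eventually (\<lambda>n. ?v n * ((ln (?v n) - 1) / 2 - ln L) \<ge> 3 / 2 * ln (real n)) sequentially"
    by real_asymp
  have 2: "eventually (\<lambda>n. (ln (?v n) - 1) / 2 - ln L \<ge> 0) sequentially"
    by real_asymp
  have 3: "eventually (\<lambda>n. ?v n > 0) sequentially"
    by real_asymp
  from 1 2 3 eventually_gt_at_top[of 0] show ?thesis
  proof eventually_elim
    case (elim n)
    let ?k = "cutoff n"
    have k: "?v n \<le> real ?k" unfolding cutoff_def by linarith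
    then have "ln (?v n) \<le> ln (real ?k)" using elim(3) by (subst ln_le_cancel_iff) auto
    \<comment> \<open>Rounding \<open>?v n\<close> up to the cutoff increases both factors, the
      second being nonnegative by then.\<close>
    then have "?v n * ((ln (?v n) - 1) / 2 - ln L) \<le> real ?k * ((ln (real ?k) - 1) / 2 - ln L)"
      using k elim(2,3) by (intro mult_mono) auto
    with elim(1) have "3 / 2 * ln (real n) \<le> real ?k * ((ln (real ?k) - 1) / 2 - ln L)"
      by (rule order_trans)
    then have "real ?k * ln L - (real ?k * ln (real ?k) - real ?k) / 2 \<le> - 3 / 2 * ln (real n)"
      by (simp add: algebra_simps diff_divide_distrib)
    moreover have "x - y / 2 \<le> z" if "x - w / 2 \<le> z" "w \<le> y" for x y z w :: real
      using that by linarith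
    ultimately have "real ?k * ln L - ln (fact ?k) / 2 \<le> - 3 / 2 * ln (real n)"
      using ln_fact_ge[of ?k] by blast
    then have "exp (real ?k * ln L - ln (fact ?k) / 2) \<le> exp (- 3 / 2 * ln (real n))" by simp
    moreover have "exp (real ?k * ln L - ln (fact ?k) / 2) = L ^ ?k / sqrt (fact ?k)"
      using L by (simp add: exp_diff exp_of_nat_mult flip: ln_sqrt)
    ultimately show ?case using elim(4) by (simp add: powr_def)
  qed
qed

lemma eventually_cutoff_le_ln: "eventually (\<lambda>n. real (cutoff n) \<le> ln (real n)) sequentially"
proof -
  have "eventually (\<lambda>n::nat. 8 * ln (real n) / ln (ln (real n)) + 1 \<le> ln (real n)) sequentially"
    by real_asymp
  moreover have "eventually (\<lambda>n::nat. 8 * ln (real n) / ln (ln (real n)) > 0) sequentially"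
    by real_asymp
  ultimately show ?thesis
    by eventually_elim (unfold cutoff_def, linarith)
qed

text \<open>Rounding up costs at most one extra factor \<open>S\<close>; the rest exchanges base and
  exponent.\<close>

lemma eventually_power_cutoff_le:
  fixes S :: real
  assumes S: "S \<ge> 1"
  shows "eventually (\<lambda>n. S ^ cutoff n \<le> S * real n powr (8 * ln S / ln (ln (real n)))) sequentially"
proof -
  have "eventually (\<lambda>n::nat. 8 * ln (real n) / ln (ln (real n)) > 0) sequentially"
    by real_asymp
  with eventually_gt_at_top[of 0] show ?thesis
  proof eventually_elim
    case (elim n)
    have "real (cutoff n) \<le> 8 * ln (real n) / ln (ln (real n)) + 1"
      using elim(2) unfolding cutoff_def by linarith
    then have "S powr real (cutoff n) \<le> S powr (8 * ln (real n) / ln (ln (real n)) + 1)"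
      using S by (intro powr_mono) auto
    also have "\<dots> = S * S powr (8 * ln (real n) / ln (ln (real n)))"
      using S by (simp add: powr_add)
    also have "S powr (8 * ln (real n) / ln (ln (real n))) = real n powr (8 * ln S / ln (ln (real n)))"
      using S elim(1) by (simp add: powr_def mult_ac)
    finally show ?case using S by (simp add: powr_realpow)
  qed
qed

text \<open>The square of \<open>2 * sqrt ts / \<sigma>\<close> is
  \<open>4 * ts / \<sigma>\<^sup>2\<close>. If this exceeds 1, the exponent produced by the cutoff
  is half the permitted one; otherwise the maximum is 1 and the extra power of \<open>n\<close>
  disappears.\<close>

lemma powr_cutoff_le_rate:
  fixes ts \<sigma> :: real
  assumes ts: "ts > 0" and \<sigma>: "\<sigma> > 0" and n: "ln (real n) \<ge> 1" "ln (ln (real n)) > 0"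
  shows "real n powr (8 * ln (max 1 (2 * sqrt ts / \<sigma>)) / ln (ln (real n))) * real n powr (- 1 / 2) * (ln (real n))\<^sup>2
    \<le> rate ts \<sigma> 2 n"
proof -
  have n1: "real n \<ge> 1"
    using n(1) by (cases n) auto
  have sq: "(2 * sqrt ts / \<sigma>)\<^sup>2 = 4 * ts / \<sigma>\<^sup>2"
    using ts by (simp add: power_mult_distrib power_divide)
  have pw: "(ln (real n))\<^sup>2 = ln (real n) powr 2"
    using n(1) by simp
  show ?thesis
  proof (cases "\<sigma>\<^sup>2 < 4 * ts")
    case True
    then have gt: "4 * ts / \<sigma>\<^sup>2 > 1" using \<sigma> by (simp add: field_simps)
    then have "1\<^sup>2 < (2 * sqrt ts / \<sigma>)\<^sup>2" unfolding sq by simp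
    then have S: "2 * sqrt ts / \<sigma> > 1"
      by (rule power_less_imp_less_base) (use ts \<sigma> in simp)
    have "ln (4 * ts / \<sigma>\<^sup>2) = 2 * ln (2 * sqrt ts / \<sigma>)"
      using S unfolding sq[symmetric] by (subst ln_realpow) auto
    then have "8 * ln (max 1 (2 * sqrt ts / \<sigma>)) \<le> 8 * ln (4 * ts / \<sigma>\<^sup>2)"
      using S ln_gt_zero[OF S] by simp
    then have "- 1 / 2 + 8 * ln (max 1 (2 * sqrt ts / \<sigma>)) / ln (ln (real n)) \<le> - 0.5 + 8 * ln (4 * ts / \<sigma>\<^sup>2) / ln (ln (real n))"
      using n(2) by (intro add_mono divide_right_mono) auto
    then have "real n powr (- 1 / 2 + 8 * ln (max 1 (2 * sqrt ts / \<sigma>)) / ln (ln (real n))) * ln (real n) powr 2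
        \<le> real n powr (- 0.5 + 8 * ln (4 * ts / \<sigma>\<^sup>2) / ln (ln (real n))) * ln (real n) powr 2"
      by (intro mult_right_mono powr_mono n1) auto
    then show ?thesis
      unfolding pw powr_add[symmetric] using True by (simp add: rate_def Let_def mult_ac add_ac)
  next
    case False
    then have "(2 * sqrt ts / \<sigma>)\<^sup>2 \<le> 1\<^sup>2" unfolding sq using \<sigma> by (simp add: field_simps)
    then have "2 * sqrt ts / \<sigma> \<le> 1" by (rule power2_le_imp_le) simp
    then have "max 1 (2 * sqrt ts / \<sigma>) = 1" by simp
    then show ?thesis
      unfolding pw using False n1 by (simp add: rate_def Let_def)
  qed
qed

theorem theorem4:
  fixes ts \<sigma> \<gamma>3 \<gamma>4 :: real
  assumes "ts > 0" and "\<sigma> > 0" and "\<gamma>3 > 0" and "\<gamma>4 > 0"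
  shows "\<exists>C > 0. \<exists>a > 0. \<exists>N :: nat.
    \<forall>(d :: nat pmf \<Rightarrow> nat pmf \<Rightarrow> real) (Qhat :: nat list \<Rightarrow> real measure).
      generalized_distance d \<longrightarrow>
      (\<forall>p q. \<gamma>3 * hellinger2 p q \<le> d p q) \<longrightarrow>
      (\<forall>p q. ennreal (d p q) \<le> ennreal \<gamma>4 * chi2 p q) \<longrightarrow>
      is_min_dist_estimator ts d Qhat \<longrightarrow>
      (\<forall>n \<ge> N. \<forall>Q. prob_on_interval ts Q \<longrightarrow>
         (\<integral>\<^sup>+ xs. W1_smooth \<sigma> Q (Qhat xs) \<partial>measure_pmf (replicate_pmf n (mix_pmf Q)))
           \<le> ennreal (C * rate ts \<sigma> a n))"
proof -
  note ts = assms(1) and \<sigma> = assms(2)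
  define S where "S = max 1 (2 * sqrt ts / \<sigma>)"
  define L where "L = max 1 (2 * ts / \<sigma>)"
  \<comment> \<open>The maximum of both bases lets one cutoff estimate control
    \<open>L ^ k / sqrt (fact k)\<close> and \<open>ts ^ k / fact k\<close> together.\<close>
  define \<Lambda> where "\<Lambda> = max L ts"
  have S: "S \<ge> 1" and L: "L \<ge> 1" and \<Lambda>: "\<Lambda> \<ge> 1" "L \<le> \<Lambda>" "ts \<le> \<Lambda>"
    by (auto simp: S_def L_def \<Lambda>_def)
  obtain A where A: "A > 0"
    and risk: "\<And>d Qhat n k Q. (\<And>p q. \<gamma>3 * hellinger2 p q \<le> d p q) \<Longrightarrow>
      (\<And>p q. ennreal (d p q) \<le> ennreal \<gamma>4 * chi2 p q) \<Longrightarrow>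
      is_min_dist_estimator ts d Qhat \<Longrightarrow> n > 0 \<Longrightarrow> prob_on_interval ts Q \<Longrightarrow>
      (\<integral>\<^sup>+ xs. W1_smooth \<sigma> Q (Qhat xs) \<partial>measure_pmf (replicate_pmf n (mix_pmf Q)))
        \<le> ennreal (A * (real k * S ^ k * (sqrt n * (real k / real n + exp ts * ts ^ k / fact k) + 1 / sqrt n)
            + L ^ k / sqrt (fact k) + real n * (exp ts * ts ^ k / fact k)))"
    unfolding S_def L_def by (rule min_dist_W1_risk[OF assms]) blast
  define E where "E = exp ts"
  have E: "E > 0" by (simp add: E_def)
  have ev_ln: "eventually (\<lambda>n::nat. ln (real n) \<ge> 1) sequentially"
    and ev_lnln: "eventually (\<lambda>n::nat. ln (ln (real n)) > 0) sequentially"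
    by real_asymp+
  have "eventually (\<lambda>n. A * (real (cutoff n) * S ^ cutoff n *
        (sqrt n * (real (cutoff n) / real n + exp ts * ts ^ cutoff n / fact (cutoff n)) + 1 / sqrt n)
        + L ^ cutoff n / sqrt (fact (cutoff n)) + real n * (exp ts * ts ^ cutoff n / fact (cutoff n)))
      \<le> A * (S * (3 + 2 * E)) * rate ts \<sigma> 2 n \<and> n > 0) sequentially"
    using eventually_power_cutoff_div_sqrt_fact_le[OF \<Lambda>(1)] eventually_cutoff_le_ln
      eventually_power_cutoff_le[OF S] ev_ln ev_lnln eventually_gt_at_top[of 0]
  proof eventually_elim
    case (elim n)
    define k where "k = cutoff n"
    define l where "l = ln (real n)"
    define r where "r = real n powr (- 1 / 2)"
    define P where "P = real n powr (8 * ln S / ln (ln (real n)))"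
    note elim = elim[folded k_def l_def P_def]
    have n: "real n > 0" using elim by simp
    have r: "r = 1 / sqrt (real n)"
      using n by (simp add: r_def powr_minus powr_half_sqrt field_simps)
    have r0: "r > 0" using n by (simp add: r_def)
    have nr: "real n powr (- 3 / 2) = r / real n"
    proof -
      have "real n powr (- 1 / 2 + - 1) = real n powr (- 1 / 2) * real n powr (- 1)"
        by (rule powr_add)
      then show ?thesis using n by (simp add: r_def powr_neg_one)
    qed
    have "real n \<ge> 1" using elim(6) by simp
    then have r1: "r / real n \<le> r" and r2: "r \<le> 1"
      using r0 by (simp_all add: divide_le_eq r)
    have P: "P \<ge> 1"
      unfolding P_def using \<open>real n \<ge> 1\<close> S elim(5) by (intro ge_one_powr_ge_zero) (auto simp: l_def)
    have Lk: "L ^ k / sqrt (fact k) \<le> r"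
    proof -
      have "L ^ k / sqrt (fact k) \<le> \<Lambda> ^ k / sqrt (fact k)"
        using L \<Lambda> by (intro divide_right_mono power_mono) auto
      then show ?thesis using elim(1) r1 unfolding nr by linarith
    qed
    define \<tau> where "\<tau> = exp ts * ts ^ k / fact k"
    have \<tau>: "real n * \<tau> \<le> E * r" "\<tau> \<ge> 0"
    proof -
      have "ts ^ k / fact k \<le> \<Lambda> ^ k / sqrt (fact k)"
        using ts \<Lambda> by (intro frac_le power_mono) (auto intro!: real_le_lsqrt simp: power2_eq_square)
      then have "ts ^ k / fact k \<le> r / real n" using elim(1) unfolding nr by linarith
      then have "E * (ts ^ k / fact k) \<le> E * (r / real n)"
        by (rule mult_left_mono) (use E in simp)
      then show "real n * \<tau> \<le> E * r" using n by (simp add: \<tau>_def E_def field_simps)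
      show "\<tau> \<ge> 0" using ts by (simp add: \<tau>_def)
    qed
    have eq: "sqrt n * (real k / real n + \<tau>) + 1 / sqrt n = r * (real k + real n * \<tau> + 1)"
      using n by (simp add: r field_simps)
    \<comment> \<open>\<open>k\<close> is at most \<open>l\<close>, \<open>n * \<tau>\<close> is at
      most \<open>E\<close>, and \<open>l\<close> is at least 1. This logarithm and the one bounding
      the outer factor \<open>k\<close> account for the power 2 in the rate.\<close>
    have in1: "r * (real k + real n * \<tau> + 1) \<le> r * (l * (2 + E))"
    proof (rule mult_left_mono)
      have "real n * \<tau> \<le> E * 1"
        using \<tau>(1) r2 E mult_left_mono[of r 1 E] by linarith
      moreover have "1 * (1 + E) \<le> l * (1 + E)"
        using elim(4) E by (intro mult_right_mono) auto
      ultimately show "real k + real n * \<tau> + 1 \<le> l * (2 + E)"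
        using elim(2) by (simp add: algebra_simps)
    qed (use r0 in simp)
    have "real k * S ^ k * (sqrt n * (real k / real n + \<tau>) + 1 / sqrt n) \<le> l * (S * P) * (r * (l * (2 + E)))"
      unfolding eq using in1 elim(2,3,4) S P \<tau>(2) r0 n by (intro mult_mono) auto
    then have m1: "real k * S ^ k * (sqrt n * (real k / real n + \<tau>) + 1 / sqrt n) \<le> S * (2 + E) * (P * r * l\<^sup>2)"
      by (simp add: power2_eq_square mult_ac)
    \<comment> \<open>The tail and the event of a large observation are of order \<open>r\<close>;
      inserting factors that are at least 1 gives them the form of the main term, and the constants
      \<open>2 + E\<close> and \<open>1 + E\<close> add up to \<open>3 + 2 * E\<close>.\<close>
    have "1 * 1 * 1 * (r * (1 + E)) \<le> S * P * l\<^sup>2 * (r * (1 + E))"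
      using S P elim(4) r0 E by (intro mult_right_mono mult_mono one_le_power) auto
    then have m2: "r + E * r \<le> S * (1 + E) * (P * r * l\<^sup>2)"
      by (simp add: algebra_simps)
    have "real k * S ^ k * (sqrt n * (real k / real n + \<tau>) + 1 / sqrt n) + L ^ k / sqrt (fact k) + real n * \<tau>
        \<le> S * (2 + E) * (P * r * l\<^sup>2) + S * (1 + E) * (P * r * l\<^sup>2)"
      using m1 m2 Lk \<tau>(1) by linarith
    also have "\<dots> = S * (3 + 2 * E) * (P * r * l\<^sup>2)"
      by (simp add: algebra_simps)
    also have "\<dots> \<le> S * (3 + 2 * E) * rate ts \<sigma> 2 n"
      unfolding P_def r_def l_def S_def
      using E elim(4,5) by (intro mult_left_mono powr_cutoff_le_rate[OF ts \<sigma>]) (auto simp: l_def)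
    finally have "real k * S ^ k * (sqrt n * (real k / real n + \<tau>) + 1 / sqrt n) + L ^ k / sqrt (fact k) + real n * \<tau>
        \<le> S * (3 + 2 * E) * rate ts \<sigma> 2 n" .
    then have "A * (real k * S ^ k * (sqrt n * (real k / real n + \<tau>) + 1 / sqrt n) + L ^ k / sqrt (fact k) + real n * \<tau>)
        \<le> A * (S * (3 + 2 * E) * rate ts \<sigma> 2 n)"
      using A by (intro mult_left_mono) auto
    then show ?case
      using elim(6) by (simp only: k_def \<tau>_def mult.assoc)
  qed
  then obtain N where N: "\<And>n. n \<ge> N \<Longrightarrow> A * (real (cutoff n) * S ^ cutoff n *
        (sqrt n * (real (cutoff n) / real n + exp ts * ts ^ cutoff n / fact (cutoff n)) + 1 / sqrt n)
        + L ^ cutoff n / sqrt (fact (cutoff n)) + real n * (exp ts * ts ^ cutoff n / fact (cutoff n)))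
      \<le> A * (S * (3 + 2 * E)) * rate ts \<sigma> 2 n" and N0: "\<And>n. n \<ge> N \<Longrightarrow> n > 0"
    unfolding eventually_sequentially by blast
  show ?thesis
  proof (rule exI[of _ "A * (S * (3 + 2 * E))"], intro conjI exI[of _ "2::real"] exI[of _ N] allI impI)
    show "A * (S * (3 + 2 * E)) > 0" using A S E by simp
  next
    fix d Qhat n Q
    assume "\<forall>p q. \<gamma>3 * hellinger2 p q \<le> d p q" "\<forall>p q. ennreal (d p q) \<le> ennreal \<gamma>4 * chi2 p q"
      "is_min_dist_estimator ts d Qhat" "N \<le> n" "prob_on_interval ts Q"
    then show "(\<integral>\<^sup>+ xs. W1_smooth \<sigma> Q (Qhat xs) \<partial>measure_pmf (replicate_pmf n (mix_pmf Q)))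
           \<le> ennreal (A * (S * (3 + 2 * E)) * rate ts \<sigma> 2 n)"
      by (intro order_trans[OF risk[where k = "cutoff n"] ennreal_leI[OF N]] N0) auto
  qed simp
qed

end
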